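(* Let $n\ge 1$ be an integer. For $q=(q_1,\dots,q_n)\in(0,\infty)^n$ let $h(q)=\zeta_{\Box}'(0)$ be the derivative at $0$ of the Dirichlet spectral zeta function of the box $[0,q_1]\times\cdots\times[0,q_n]$, and let $g(q)=\prod_{j=1}^n q_j^2-1$. Then the equilateral box $q=(1,\dots,1)$ satisfies the Lagrange multiplier system for extremizing $h$ under the constraint $g=0$: one has $g(1,\dots,1)=0$ and there exists $\lambda\in\mathbb{R}$ such that $\frac{\partial h}{\partial q_j}(1,\dots,1)=\lambda\,\frac{\partial g}{\partial q_j}(1,\dots,1)$ for all $j=1,\dots,n$.
   Context: The eigenvalues of the (nonnegative) Laplacian with Dirichlet boundary condition on $[0,q_1]\times\cdots\times[0,q_n]$, counted with multiplicity, are $\pi^2\sum_{j=1}^n k_j^2/q_j^2$ with $k=(k_1,\dots,k_n)$ ranging over all $n$-tuples of positive integers. The Dirichlet spectral zeta function is $\zeta_{\Box}(s)=\sum_{k}\left(\pi^2\sum_{j=1}^n k_j^2/q_j^2\right)^{-s}$ for $\operatorname{Re}(s)>n/2$, the sum running over $n$-tuples of positive integers. It extends meromorphically to $\mathbb{C}$ and is holomorphic near $s=0$; $\zeta_{\Box}'(0)$ is computed from this continuation. The zeta regularized determinant is $e^{-\zeta_{\Box}'(0)}$, so the Lagrange system is a necessary condition for a maximizer of the determinant among boxes of unit volume. *)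

theory Defs
  imports "HOL-Complex_Analysis.Complex_Analysis"
begin

definition dirichlet_eigenvalue :: "real ^ 'n \<Rightarrow> ('n::finite \<Rightarrow> nat) \<Rightarrow> real" where
  "dirichlet_eigenvalue q k = pi\<^sup>2 * (\<Sum>j\<in>UNIV. (real (k j))\<^sup>2 / (q $ j)\<^sup>2)"

definition dirichlet_zeta_series :: "real ^ 'n \<Rightarrow> complex \<Rightarrow> complex" where
  "dirichlet_zeta_series q s =
     (\<Sum>\<^sub>\<infinity>k\<in>{k :: 'n::finite \<Rightarrow> nat. \<forall>j. k j > 0}.
        complex_of_real (dirichlet_eigenvalue q k) powr (- s))"

definition is_dirichlet_zeta :: "real ^ 'n::finite \<Rightarrow> (complex \<Rightarrow> complex) \<Rightarrow> bool" where
  "is_dirichlet_zeta q f \<longleftrightarrow>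
     f nicely_meromorphic_on UNIV \<and>
     (\<forall>s. Re s > real CARD('n) / 2 \<longrightarrow> f s = dirichlet_zeta_series q s)"

text \<open>
  A meromorphic function has no canonical values at its poles and may carry arbitrary values at
  removable singularities; requiring \<open>nicely_meromorphic_on\<close> normalises both, which makes the
  meromorphic continuation of the series unique as a total function.
\<close>

lemma is_dirichlet_zeta_unique:
  fixes   q :: "real ^ 'n::finite"
  assumes "is_dirichlet_zeta q f" "is_dirichlet_zeta q g"
  shows   "f = g"
proof
  fix z
  let ?n = "real CARD('n)"
  define h where "h = (\<lambda>z. f z - g z)"
  define w where "w = complex_of_real (?n / 2 + 1)"
  have h: "h meromorphic_on UNIV"
    using assms unfolding h_def is_dirichlet_zeta_def nicely_meromorphic_on_def
    by (intro meromorphic_on_diff) auto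
  have half: "eventually (\<lambda>s. Re s > ?n / 2) (nhds w)"
    using eventually_nhds_in_open[OF open_halfspace_Re_gt, of w "?n / 2"] by (simp add: w_def)
  have "eventually (\<lambda>s. h s = 0) (nhds w)"
    using half by eventually_elim (use assms in \<open>auto simp: h_def is_dirichlet_zeta_def\<close>)
  then have "eventually (\<lambda>s. h s = 0) (at w)"
    by (simp add: eventually_nhds_conv_at)
  moreover have "eventually (\<lambda>s. remove_sings h s = h s) (at w)"
    using h by (intro eventually_remove_sings_eq_at)
      (auto intro: meromorphic_on_isolated_singularity meromorphic_on_subset)
  ultimately have "eventually (\<lambda>s. remove_sings h s = 0) (at w)"
    by eventually_elim auto
  then have "frequently (\<lambda>s. remove_sings h s = 0) (at w)"
    by (intro eventually_frequently) auto
  then have 0: "remove_sings h s = 0" for s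
    by (rule frequently_eq_meromorphic_imp_constant)
       (use h in \<open>auto intro: remove_sings_nicely_meromorphic\<close>)
  have "eventually (\<lambda>s. remove_sings h s = h s) (at z)"
    using h by (intro eventually_remove_sings_eq_at)
      (auto intro: meromorphic_on_isolated_singularity meromorphic_on_subset)
  then have eq: "eventually (\<lambda>s. f s = g s) (at z)"
    by eventually_elim (simp add: 0, simp add: h_def)
  have pole: "is_pole f z \<longleftrightarrow> is_pole g z"
    using eq by (intro is_pole_cong) auto
  have lim: "(f \<longlongrightarrow> c) (at z) \<longleftrightarrow> (g \<longlongrightarrow> c) (at z)" for c
    using eq by (intro filterlim_cong) auto
  have "(is_pole f z \<and> f z = 0) \<or> f \<midarrow>z\<rightarrow> f z" "(is_pole g z \<and> g z = 0) \<or> g \<midarrow>z\<rightarrow> g z"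
    using assms by (auto simp: is_dirichlet_zeta_def nicely_meromorphic_on_def)
  then show "f z = g z"
    using pole lim[of "f z"] lim[of "g z"] tendsto_unique[of "at z" g "f z" "g z"]
      not_tendsto_and_filterlim_at_infinity[of "at z" g]
    by (auto simp: is_pole_def)
qed

definition dirichlet_zeta :: "real ^ 'n::finite \<Rightarrow> complex \<Rightarrow> complex" where
  "dirichlet_zeta q = (THE f. is_dirichlet_zeta q f)"

text \<open>
  \<open>zeta_prime_zero\<close> is left complex-valued: its value for a box is real, but that is a theorem
  rather than part of the definition.
\<close>

definition zeta_prime_zero :: "real ^ 'n::finite \<Rightarrow> complex" where
  "zeta_prime_zero q = deriv (dirichlet_zeta q) 0"

definition volume_constraint :: "real ^ 'n::finite \<Rightarrow> real" where
  "volume_constraint q = (\<Prod>j\<in>UNIV. (q $ j)\<^sup>2) - 1"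

definition equilateral_box :: "real ^ 'n::finite" where
  "equilateral_box = (\<chi> j. 1)"

definition has_partial_derivative ::
  "(real ^ 'n::finite \<Rightarrow> 'a::real_normed_vector) \<Rightarrow> 'a \<Rightarrow> 'n \<Rightarrow> real ^ 'n \<Rightarrow> bool" where
  "has_partial_derivative F D j q \<longleftrightarrow>
     ((\<lambda>t. F (\<chi> i. if i = j then t else q $ i)) has_vector_derivative D) (at (q $ j))"

end

theory Submission
  imports Defs
begin

text \<open>
  With \<open>theta x = (\<Sum>k\<ge>1. exp (- pi\<^sup>2 x k\<^sup>2))\<close>, the heat trace of the box whose sides are \<open>1\<close>
  except for one side \<open>t\<close> is \<open>theta x ^ (n - 1) * theta (x / t\<^sup>2)\<close>, and its Mellin transform is
  \<open>Gamma s\<close> times the zeta function. As \<open>x \<rightarrow> 0\<close>, \<open>theta x = c / (2 sqrt x) - 1 / 2\<close> up to an error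
  that is smaller than any power of \<open>x\<close>, and likewise for the derivative. Subtracting the resulting
  polynomial in \<open>1 / sqrt x\<close> on \<open>(0, 1]\<close> leaves an entire Mellin transform, while the subtracted part
  contributes explicit poles whose residues are affine in \<open>t\<close>. Hence \<open>zeta'(0)\<close> is, up to a constant
  independent of \<open>t\<close>, a real integral that can be differentiated in \<open>t\<close> under the integral sign. The
  formula does not mention which side is varied, so all the partial derivatives at the equilateral
  box agree, as do those of the constraint.

  The error estimate needs neither Poisson summation nor Euler-Maclaurin: a \<open>1\<close>-periodic function
  whose derivative is \<open>h\<close> times a function of the same kind is \<open>O(h ^ N)\<close> for every \<open>N\<close> once it has a
  zero, by induction with the mean value theorem. The constant \<open>c\<close> need not be computed.
\<close>

section \<open>Gaussian lattice sums\<close>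

text \<open>The argument with periodic functions controls only lattice sums of derivatives, and the
  lattice sum of \<open>exp (- y^2)\<close> is not of that kind. The factor \<open>sqrt x\<close>
  repairs this: with \<open>y = pi * sqrt x * k\<close>, the derivative in \<open>x\<close> of
  \<open>sqrt x * exp (- y^2)\<close> is \<open>(1 - 2 * y^2) * exp (- y^2) / (2 * sqrt x)\<close>,
  and \<open>(1 - 2 * y^2) * exp (- y^2)\<close> is the derivative of
  \<open>y * exp (- y^2)\<close>. So \<open>sqrt x * (1 + 2 * theta x)\<close> has a derivative that
  is smaller than any power of \<open>x\<close>, and its limit at \<open>0\<close> is the constant
  \<open>c\<close>. The residues are affine in \<open>t\<close> because \<open>t\<close> enters the
  subtracted polynomial through the single factor \<open>t * c / (2 * sqrt x) - 1 / 2\<close>. The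
  constant term of that polynomial is free of \<open>t\<close>. It multiplies the derivative of
  \<open>rGamma\<close> at \<open>1\<close>, the one quantity in the formula that is not visibly
  real. This is why the partial derivatives come out real although \<open>zeta_prime_zero\<close> is
  complex-valued.\<close>

definition gauss :: "real poly \<Rightarrow> real \<Rightarrow> real" where
  "gauss p y = poly p y * exp (- y\<^sup>2)"

text \<open>Polynomials times the Gaussian are closed under differentiation; this is what allows an
  induction over all \<open>p\<close> at once.\<close>

definition gauss_deriv :: "real poly \<Rightarrow> real poly" where
  "gauss_deriv p = pderiv p - [:0, 2:] * p"

lemma DERIV_gauss: "(gauss p has_real_derivative gauss (gauss_deriv p) y) (at y)"
  unfolding gauss_def[abs_def] gauss_deriv_def
  by (auto intro!: derivative_eq_intros simp: algebra_simps)

lemma power_le_fact_mult_exp: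
  fixes x :: real
  assumes "x \<ge> 0"
  shows   "x ^ n \<le> fact n * exp x"
proof -
  have "(\<Sum>k\<in>{n}. x ^ k /\<^sub>R fact k) \<le> (\<Sum>k. x ^ k /\<^sub>R fact k)"
    using summable_exp_generic[of x] assms by (intro sum_le_suminf) auto
  also have "\<dots> = exp x"
    by (simp add: exp_def)
  finally show ?thesis
    by (simp add: field_simps)
qed

text \<open>The weaker decay \<open>exp (- \<bar>y\<bar>)\<close> is chosen because it turns lattice
  sums into geometric series.\<close>

lemma gauss_le_exp:
  obtains C where "C > 0" "\<And>y. \<bar>gauss p y\<bar> \<le> C * exp (- \<bar>y\<bar>)"
proof -
  define S where "S = 1 + (\<Sum>i\<le>degree p. \<bar>coeff p i\<bar> * fact i)"
  have "S > 0"
    unfolding S_def by (intro add_pos_nonneg sum_nonneg) auto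
  have "\<bar>gauss p y\<bar> \<le> (S * exp 1) * exp (- \<bar>y\<bar>)" for y
  proof -
    have "\<bar>poly p y\<bar> \<le> (\<Sum>i\<le>degree p. \<bar>coeff p i\<bar> * \<bar>y\<bar> ^ i)"
      unfolding poly_altdef by (intro order_trans[OF sum_abs]) (simp add: abs_mult power_abs)
    also have "\<dots> \<le> (\<Sum>i\<le>degree p. \<bar>coeff p i\<bar> * (fact i * exp \<bar>y\<bar>))"
      by (intro sum_mono mult_left_mono power_le_fact_mult_exp) auto
    also have "\<dots> \<le> S * exp \<bar>y\<bar>"
      by (simp add: S_def sum_distrib_right[symmetric] mult.assoc[symmetric])
    finally have "\<bar>gauss p y\<bar> \<le> S * (exp \<bar>y\<bar> * exp (-y\<^sup>2))"
      unfolding gauss_def by (simp add: abs_mult mult.assoc[symmetric])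
    moreover have "exp \<bar>y\<bar> * exp (-y\<^sup>2) \<le> exp 1 * exp (-\<bar>y\<bar>)"
    proof -
      \<comment> \<open>This is \<open>(\<bar>y\<bar> - 1)^2 \<ge> 0\<close> rearranged, which is
        where the factor \<open>exp 1\<close> comes from.\<close>
      have "\<bar>y\<bar> + -y\<^sup>2 \<le> 1 + -\<bar>y\<bar>"
        using zero_le_power2[of "\<bar>y\<bar> - 1"] by (simp add: power2_diff)
      then show ?thesis
        by (simp add: exp_add[symmetric])
    qed
    then have "S * (exp \<bar>y\<bar> * exp (-y\<^sup>2)) \<le> S * (exp 1 * exp (-\<bar>y\<bar>))"
      using \<open>S > 0\<close> by (intro mult_left_mono) auto
    ultimately show ?thesis by (simp add: mult.assoc)
  qed
  with \<open>S > 0\<close> show ?thesis using that[of "S * exp 1"] by simp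
qed

lemma summable_exp_minus_mult:
  fixes h :: real
  assumes "h > 0"
  shows   "summable (\<lambda>k. exp (- h * real k))"
proof -
  have "summable (\<lambda>k. exp (-h) ^ k)"
    using assms by (intro summable_geometric) simp
  then show ?thesis
    by (simp add: exp_of_nat_mult[symmetric] mult_ac)
qed

lemma suminf_exp_minus_mult_le:
  fixes h :: real
  assumes "h > 0"
  shows   "(\<Sum>k. exp (- h * real k)) \<le> 1 + 1 / h"
proof -
  have "(\<Sum>k. exp (- h * real k)) = (\<Sum>k. exp (-h) ^ k)"
    by (simp add: exp_of_nat_mult[symmetric] mult_ac)
  also have "\<dots> = 1 / (1 - exp (-h))"
    using assms by (intro suminf_geometric) simp
  also have "\<dots> \<le> 1 + 1 / h"
  proof -
    have "exp (-h) \<le> 1 / (1 + h)"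
      using assms exp_ge_add_one_self[of h] by (simp add: exp_minus field_simps)
    then have "h / (1 + h) \<le> 1 - exp (-h)"
      using assms by (simp add: field_simps)
    then have "1 / (1 - exp (-h)) \<le> 1 / (h / (1 + h))"
      using assms by (intro divide_left_mono mult_pos_pos) auto
    then show ?thesis
      using assms by (simp add: field_simps)
  qed
  finally show ?thesis .
qed

definition gauss_term :: "real poly \<Rightarrow> real \<Rightarrow> real \<Rightarrow> nat \<Rightarrow> real" where
  "gauss_term p h u k = gauss p (h * (real k + u)) + gauss p (h * (u - 1 - real k))"

text \<open>The two-sided sum over all integers, folded into a sum over \<open>k \<ge> 0\<close>.\<close>

definition gauss_sum :: "real poly \<Rightarrow> real \<Rightarrow> real \<Rightarrow> real" where
  "gauss_sum p h u = (\<Sum>k. gauss_term p h u k)"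

text \<open>The parameter \<open>a\<close> serves two purposes. With \<open>a = -1\<close> the bound
  holds on an open neighbourhood of \<open>[0, 1]\<close>, as termwise differentiation requires, at
  the price of a factor \<open>exp h\<close>. With \<open>a = 0\<close> it covers exactly
  \<open>[0, 1]\<close> and the constant no longer depends on \<open>h\<close>.\<close>

lemma gauss_term_le_exp:
  obtains C where "C > 0"
    "\<And>h u k a. h > 0 \<Longrightarrow> a \<le> u \<Longrightarrow> u \<le> 1 - a \<Longrightarrow> a \<le> 0 \<Longrightarrow>
        \<bar>gauss_term p h u k\<bar> \<le> 2 * C * exp (- h * a) * exp (- h * real k)"
proof -
  obtain C where C: "C > 0" "\<And>y. \<bar>gauss p y\<bar> \<le> C * exp (- \<bar>y\<bar>)"
    using gauss_le_exp by blast
  have "\<bar>gauss_term p h u k\<bar> \<le> 2 * C * exp (- h * a) * exp (- h * real k)"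
    if "h > 0" "a \<le> u" "u \<le> 1 - a" "a \<le> 0" for h u a :: real and k
  proof -
    have *: "\<bar>gauss p y\<bar> \<le> C * exp (- h * a - h * real k)" if "\<bar>y\<bar> \<ge> h * (real k + a)" for y
      using C(1) that by (intro order_trans[OF C(2)]) (auto simp: algebra_simps)
    have "h * (real k + a) \<le> h * (real k + u)" "h * (real k + a) \<le> h * (real k + 1 - u)"
      using that by (auto intro!: mult_left_mono)
    then have "h * (real k + a) \<le> \<bar>h * (real k + u)\<bar>" "h * (real k + a) \<le> \<bar>h * (u - 1 - real k)\<bar>"
      by (auto simp: algebra_simps)
    from this[THEN *] show ?thesis
      unfolding gauss_term_def by (auto simp: exp_add[symmetric] algebra_simps)
  qed
  then show ?thesis using C(1) that by blast
qed

lemma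
  assumes "h > 0" "-1 < u" "u < 2"
  shows summable_gauss_term: "summable (gauss_term p h u)"
    and DERIV_gauss_sum:
      "(gauss_sum p h has_real_derivative h * gauss_sum (gauss_deriv p) h u) (at u)"
proof -
  have summable: "summable (gauss_term p h u)" if "-1 < u" "u < 2" for p u
  proof -
    obtain C where C: "C > 0" "\<And>h u k a. h > 0 \<Longrightarrow> a \<le> u \<Longrightarrow> u \<le> 1 - a \<Longrightarrow> a \<le> 0 \<Longrightarrow>
        \<bar>gauss_term p h u k\<bar> \<le> 2 * C * exp (- h * a) * exp (- h * real k)"
      using gauss_term_le_exp[of p] by blast
    show ?thesis
    proof (rule summable_comparison_test')
      show "summable (\<lambda>k. 2 * C * exp (- h * (-1)) * exp (- h * real k))"
        by (intro summable_mult summable_exp_minus_mult assms)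
      show "norm (gauss_term p h u k) \<le> 2 * C * exp (- h * (-1)) * exp (- h * real k)" if "k \<ge> 0" for k
        unfolding real_norm_def using C(2)[of h "-1" u k] assms(1) \<open>-1 < u\<close> \<open>u < 2\<close> by simp
    qed
  qed
  show "summable (gauss_term p h u)"
    using assms summable by blast
  obtain C where C: "C > 0" "\<And>h u k a. h > 0 \<Longrightarrow> a \<le> u \<Longrightarrow> u \<le> 1 - a \<Longrightarrow> a \<le> 0 \<Longrightarrow>
        \<bar>gauss_term (gauss_deriv p) h u k\<bar> \<le> 2 * C * exp (- h * a) * exp (- h * real k)"
    using gauss_term_le_exp[of "gauss_deriv p"] by blast
  have "((\<lambda>u. \<Sum>k. gauss_term p h u k) has_real_derivative
          (\<Sum>k. h * gauss_term (gauss_deriv p) h u k)) (at u)"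
  proof (rule has_field_derivative_series'(2)[where S = "{-1<..<2}" and x0 = u])
    show "((\<lambda>u. gauss_term p h u k) has_real_derivative h * gauss_term (gauss_deriv p) h v k)
            (at v within {-1<..<2})" for k v
      unfolding gauss_term_def
      by (rule derivative_eq_intros DERIV_chain2[OF DERIV_gauss] refl)+ (simp add: algebra_simps)
    show "uniformly_convergent_on {-1<..<2} (\<lambda>n u. \<Sum>k<n. h * gauss_term (gauss_deriv p) h u k)"
    proof (rule Weierstrass_m_test')
      show "summable (\<lambda>k. h * (2 * C * exp (- h * (-1)) * exp (- h * real k)))"
        by (intro summable_mult summable_exp_minus_mult assms)
      show "norm (h * gauss_term (gauss_deriv p) h u k)
              \<le> h * (2 * C * exp (- h * (-1)) * exp (- h * real k))" if "u \<in> {-1<..<2}" for k u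
        unfolding real_norm_def abs_mult using C(2)[of h "-1" u k] assms(1) that
        by (auto intro!: mult_mono)
    qed
  qed (use assms summable in \<open>auto simp: interior_open\<close>)
  moreover have "(\<Sum>k. h * gauss_term (gauss_deriv p) h u k) = h * gauss_sum (gauss_deriv p) h u"
    unfolding gauss_sum_def using assms by (intro suminf_mult summable) auto
  ultimately show "(gauss_sum p h has_real_derivative h * gauss_sum (gauss_deriv p) h u) (at u)"
    by (simp add: gauss_sum_def[abs_def])
qed

lemma gauss_sum_bound:
  obtains C where "C > 0"
    "\<And>h u. h > 0 \<Longrightarrow> 0 \<le> u \<Longrightarrow> u \<le> 1 \<Longrightarrow> \<bar>gauss_sum p h u\<bar> \<le> C * (1 + 1 / h)"
proof -
  obtain C where C: "C > 0" "\<And>h u k a. h > 0 \<Longrightarrow> a \<le> u \<Longrightarrow> u \<le> 1 - a \<Longrightarrow> a \<le> 0 \<Longrightarrow>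
        \<bar>gauss_term p h u k\<bar> \<le> 2 * C * exp (- h * a) * exp (- h * real k)"
    using gauss_term_le_exp[of p] by blast
  have "\<bar>gauss_sum p h u\<bar> \<le> 2 * C * (1 + 1 / h)" if "h > 0" "0 \<le> u" "u \<le> 1" for h u
  proof -
    have "norm (\<Sum>k. gauss_term p h u k) \<le> (\<Sum>k. 2 * C * exp (- h * real k))"
      using C(2)[of h 0 u] that
      by (intro norm_suminf_le summable_mult summable_exp_minus_mult) auto
    also have "\<dots> = 2 * C * (\<Sum>k. exp (- h * real k))"
      using that by (intro suminf_mult summable_exp_minus_mult)
    also have "\<dots> \<le> 2 * C * (1 + 1 / h)"
      using C(1) that by (intro mult_left_mono suminf_exp_minus_mult_le) auto
    finally show ?thesis by (simp add: gauss_sum_def)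
  qed
  then show ?thesis using C(1) that[of "2 * C"] by simp
qed

text \<open>In the folded form, moving \<open>u\<close> from \<open>0\<close> to \<open>1\<close>
  shifts the right half of the lattice outwards and the left half inwards. The termwise differences
  form two telescoping series, whose sums \<open>- gauss p 0\<close> and \<open>gauss p 0\<close>
  cancel.\<close>

lemma gauss_sum_periodic:
  assumes "h > 0"
  shows   "gauss_sum p h 0 = gauss_sum p h 1"
proof -
  have 0: "summable (\<lambda>k. gauss_term p h 0 k)" and 1: "summable (\<lambda>k. gauss_term p h 1 k)"
    by (rule summable_gauss_term; use assms in simp)+
  have telescope: "(\<lambda>k. gauss p (h * real (Suc k)) - gauss p (h * real k)) sums (0 - gauss p (h * real 0))"
  and "(\<lambda>k. gauss p (- (h * real k)) - gauss p (- (h * real (Suc k)))) sums (gauss p (-(h * real 0)) - 0)"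
  proof -
    obtain C where C: "C > 0" "\<And>y. \<bar>gauss p y\<bar> \<le> C * exp (- \<bar>y\<bar>)"
      using gauss_le_exp by blast
    have lim: "(\<lambda>k. C * exp (- h * real k)) \<longlonglongrightarrow> 0"
      using tendsto_mult_right_zero[OF summable_LIMSEQ_zero[OF summable_exp_minus_mult[OF assms]]] .
    have "norm (gauss p (h * real k)) \<le> C * exp (- h * real k)"
      "norm (gauss p (- (h * real k))) \<le> C * exp (- h * real k)" for k
      using C(2)[of "h * real k"] C(2)[of "- (h * real k)"] assms by (simp_all add: abs_mult)
    then have "(\<lambda>k. gauss p (h * real k)) \<longlonglongrightarrow> 0" "(\<lambda>k. gauss p (- (h * real k))) \<longlonglongrightarrow> 0"
      by (intro Lim_null_comparison[OF _ lim] always_eventually allI; simp)+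
    from telescope_sums[OF this(1)] telescope_sums'[OF this(2)]
    show "(\<lambda>k. gauss p (h * real (Suc k)) - gauss p (h * real k)) sums (0 - gauss p (h * real 0))"
      and "(\<lambda>k. gauss p (- (h * real k)) - gauss p (- (h * real (Suc k)))) sums (gauss p (-(h * real 0)) - 0)"
      by simp_all
  qed
  from sums_add[OF this]
  have "(\<lambda>k. gauss_term p h 1 k - gauss_term p h 0 k) sums 0"
    by (simp add: gauss_term_def algebra_simps)
  moreover have "(\<lambda>k. gauss_term p h 1 k - gauss_term p h 0 k) sums (gauss_sum p h 1 - gauss_sum p h 0)"
    unfolding gauss_sum_def by (intro sums_diff summable_sums 0 1)
  ultimately show ?thesis
    using sums_unique2 by fastforce
qed

text \<open>
  By periodicity and Rolle, \<open>gauss_sum (gauss_deriv p) h\<close> has a zero in \<open>[0, 1]\<close>, hence it is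
  bounded by the supremum of its own derivative, which carries an additional factor \<open>h\<close>.
\<close>

lemma gauss_sum_deriv_rapid:
  "\<exists>C>0. \<forall>h>0. \<forall>u. 0 \<le> u \<longrightarrow> u \<le> 1 \<longrightarrow>
     \<bar>gauss_sum (gauss_deriv p) h u\<bar> \<le> C * h ^ N * (1 + 1 / h)"
proof (induction N arbitrary: p)
  case 0
  obtain C where "C > 0" "\<And>h u. h > 0 \<Longrightarrow> 0 \<le> u \<Longrightarrow> u \<le> 1 \<Longrightarrow>
      \<bar>gauss_sum (gauss_deriv p) h u\<bar> \<le> C * (1 + 1 / h)"
    using gauss_sum_bound by blast
  then show ?case by auto
next
  case (Suc N)
  let ?g = "gauss_sum (gauss_deriv p)" and ?g' = "gauss_sum (gauss_deriv (gauss_deriv p))"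
  obtain C where C: "C > 0" "\<And>h u. h > 0 \<Longrightarrow> 0 \<le> u \<Longrightarrow> u \<le> 1 \<Longrightarrow> \<bar>?g' h u\<bar> \<le> C * h ^ N * (1 + 1 / h)"
    using Suc.IH[of "gauss_deriv p"] by blast
  have "\<bar>?g h u\<bar> \<le> C * h ^ Suc N * (1 + 1 / h)" if h: "h > 0" and u: "0 \<le> u" "u \<le> 1" for h u
  proof -
    have "\<exists>z>0. z < 1 \<and> gauss_sum p h 1 - gauss_sum p h 0 = (1 - 0) * (h * ?g h z)"
      by (rule MVT2) (use h in \<open>auto intro!: DERIV_gauss_sum\<close>)
    then obtain z where z: "0 < z" "z < 1" "?g h z = 0"
      using gauss_sum_periodic[OF h, of p] h by auto
    have "norm (?g h u - ?g h z) \<le> (h * (C * h ^ N * (1 + 1 / h))) * norm (u - z)"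
    proof (rule field_differentiable_bound[where S = "{0..1}" and f' = "\<lambda>u. h * ?g' h u"])
      show "(?g h has_real_derivative h * ?g' h v) (at v within {0..1})" if "v \<in> {0..1}" for v
        by (rule has_field_derivative_at_within[OF DERIV_gauss_sum]) (use that h in auto)
      show "norm (h * ?g' h v) \<le> h * (C * h ^ N * (1 + 1 / h))" if "v \<in> {0..1}" for v
        using that h C(2)[of h v] by (auto simp: abs_mult intro!: mult_left_mono)
    qed (use u z in auto)
    also have "\<dots> \<le> (h * (C * h ^ N * (1 + 1 / h))) * 1"
      using h u z C(1) by (intro mult_left_mono) auto
    finally show ?thesis using z(3) by (simp only: diff_0_right real_norm_def power_Suc mult_1_right mult_ac)
  qed
  then show ?case using C(1) by blast
qed

section \<open>The theta function near zero\<close>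

definition theta_term :: "real \<Rightarrow> nat \<Rightarrow> real" where
  "theta_term x k = exp (- (pi\<^sup>2 * x * (real (Suc k))\<^sup>2))"

definition theta :: "real \<Rightarrow> real" where
  "theta x = (\<Sum>k. theta_term x k)"

definition theta_deriv_term :: "real \<Rightarrow> nat \<Rightarrow> real" where
  "theta_deriv_term x k = - (pi\<^sup>2 * (real (Suc k))\<^sup>2 * exp (- (pi\<^sup>2 * x * (real (Suc k))\<^sup>2)))"

definition theta_deriv :: "real \<Rightarrow> real" where
  "theta_deriv x = (\<Sum>k. theta_deriv_term x k)"

text \<open>From \<open>pi > 3\<close> and \<open>1 + k \<le> (1 + k)^2\<close>: the exponents
  become linear in \<open>k\<close>, so the theta series are dominated by geometric series of ratio
  \<open>exp (- 9 * x)\<close>.\<close>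

lemma nine_le_pi_squared_mult: "x \<ge> 0 \<Longrightarrow> 9 * x * (1 + real k) \<le> pi\<^sup>2 * x * (real (Suc k))\<^sup>2"
proof -
  assume x: "x \<ge> 0"
  have "3 ^ 2 \<le> pi\<^sup>2"
    using pi_gt3 by (intro power_mono) auto
  moreover have "(1 + real k) \<le> (real (Suc k))\<^sup>2"
    by (simp add: power2_eq_square algebra_simps)
  ultimately show ?thesis
    using x by (intro mult_mono) auto
qed

lemma theta_term_le:
  assumes "x > 0"
  shows   "theta_term x k \<le> exp (- 9 * x) * exp (- (9 * x) * real k)"
  unfolding theta_term_def exp_add[symmetric]
  using nine_le_pi_squared_mult[of x k] assms by (simp add: algebra_simps)

text \<open>Half of the exponential decay pays for one linear factor. The inequality
  \<open>z \<le> (1 + z / 4)^2\<close> is \<open>(1 - z / 4)^2 \<ge> 0\<close>.\<close>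

lemma mult_exp_minus_le:
  fixes z :: real
  assumes "z \<ge> 0"
  shows   "z * exp (- z) \<le> exp (- z / 2)"
proof -
  have "z \<le> (1 + z / 4)\<^sup>2"
    using zero_le_power2[of "1 - z / 4"] by (simp add: power2_eq_square algebra_simps)
  also have "\<dots> \<le> (exp (z / 4))\<^sup>2"
    using assms by (intro power_mono exp_ge_add_one_self) auto
  also have "\<dots> = exp (z / 2)"
    by (simp add: power2_eq_square exp_add[symmetric])
  finally have "z * exp (- z) \<le> exp (z / 2) * exp (- z)"
    by (intro mult_right_mono) auto
  then show ?thesis
    by (simp add: exp_add[symmetric])
qed

text \<open>The factor brought down by differentiation costs half the exponent: the rate
  \<open>9\<close> drops to \<open>9 / 2\<close>, rounded down to \<open>4\<close>.\<close>

lemma theta_deriv_term_le: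
  assumes "x > 0"
  shows   "\<bar>theta_deriv_term x k\<bar> \<le> exp (- 4 * x) / x * exp (- (4 * x) * real k)"
proof -
  define z where "z = pi\<^sup>2 * x * (real (Suc k))\<^sup>2"
  have z: "z \<ge> 9 * x * (1 + real k)" "z \<ge> 0"
    using nine_le_pi_squared_mult[of x k] assms by (auto simp: z_def)
  have "\<bar>theta_deriv_term x k\<bar> = z * exp (- z) / x"
    using assms by (simp add: theta_deriv_term_def z_def abs_mult field_simps)
  also have "\<dots> \<le> exp (- z / 2) / x"
    using assms z by (intro divide_right_mono mult_exp_minus_le) auto
  also have "\<dots> \<le> exp (- 4 * x - (4 * x) * real k) / x"
  proof -
    have "8 * x * (1 + real k) \<le> 9 * x * (1 + real k)"
      using assms by (intro mult_right_mono) auto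
    then have "- z / 2 \<le> - 4 * x - (4 * x) * real k"
      using z(1) by (simp add: algebra_simps)
    then show ?thesis
      using assms by (intro divide_right_mono) auto
  qed
  finally show ?thesis
    by (simp add: exp_diff exp_minus field_simps)
qed

lemma summable_theta_term:
  assumes "x > 0"
  shows   "summable (theta_term x)"
proof (rule summable_comparison_test')
  show "summable (\<lambda>k. exp (- 9 * x) * exp (- (9 * x) * real k))"
    using assms by (intro summable_mult summable_exp_minus_mult) auto
  show "norm (theta_term x k) \<le> exp (- 9 * x) * exp (- (9 * x) * real k)" if "k \<ge> 0" for k
    using theta_term_le[OF assms, of k] by (simp add: theta_term_def)
qed

lemma summable_theta_deriv_term:
  assumes "x > 0"
  shows   "summable (theta_deriv_term x)"
proof (rule summable_comparison_test')
  show "summable (\<lambda>k. exp (- 4 * x) / x * exp (- (4 * x) * real k))"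
    using assms by (intro summable_mult summable_exp_minus_mult) auto
  show "norm (theta_deriv_term x k) \<le> exp (- 4 * x) / x * exp (- (4 * x) * real k)" if "k \<ge> 0" for k
    using theta_deriv_term_le[OF assms, of k] by simp
qed

lemma theta_pos: "x > 0 \<Longrightarrow> theta x > 0"
  unfolding theta_def by (intro suminf_pos summable_theta_term) (auto simp: theta_term_def)

lemma theta_le:
  assumes "x > 0"
  shows   "theta x \<le> exp (- 9 * x) * (1 + 1 / (9 * x))"
proof -
  have "theta x \<le> (\<Sum>k. exp (- 9 * x) * exp (- (9 * x) * real k))"
    unfolding theta_def using assms
    by (intro suminf_le theta_term_le summable_theta_term summable_mult summable_exp_minus_mult) auto
  also have "\<dots> = exp (- 9 * x) * (\<Sum>k. exp (- (9 * x) * real k))"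
    using assms by (intro suminf_mult summable_exp_minus_mult) auto
  also have "\<dots> \<le> exp (- 9 * x) * (1 + 1 / (9 * x))"
    using assms by (intro mult_left_mono suminf_exp_minus_mult_le) auto
  finally show ?thesis .
qed

lemma abs_theta_deriv_le:
  assumes "x > 0"
  shows   "\<bar>theta_deriv x\<bar> \<le> exp (- 4 * x) / x * (1 + 1 / (4 * x))"
proof -
  have "norm (theta_deriv x) \<le> (\<Sum>k. exp (- 4 * x) / x * exp (- (4 * x) * real k))"
    unfolding theta_deriv_def using assms theta_deriv_term_le
    by (intro norm_suminf_le summable_mult summable_exp_minus_mult) auto
  also have "\<dots> = exp (- 4 * x) / x * (\<Sum>k. exp (- (4 * x) * real k))"
    using assms by (intro suminf_mult summable_exp_minus_mult) auto
  also have "\<dots> \<le> exp (- 4 * x) / x * (1 + 1 / (4 * x))"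
    using assms by (intro mult_left_mono suminf_exp_minus_mult_le) auto
  finally show ?thesis by simp
qed

text \<open>The threshold \<open>1/4\<close> and the rate \<open>4\<close> fit the later argument
  \<open>x / t^2\<close>, which is at least \<open>x / 4\<close> for \<open>t \<le> 2\<close>: for
  \<open>x \<ge> 1\<close> a clean decay \<open>exp (- x)\<close> results.\<close>

lemma theta_le_exp: "x \<ge> 1/4 \<Longrightarrow> theta x \<le> 2 * exp (- 4 * x)"
proof -
  assume x: "x \<ge> 1/4"
  have "theta x \<le> exp (- 9 * x) * (1 + 1 / (9 * x))"
    using x by (intro theta_le) auto
  also have "\<dots> \<le> exp (- 4 * x) * 2"
    using x by (intro mult_mono) (auto simp: field_simps)
  finally show ?thesis by simp
qed

lemma abs_theta_deriv_le_exp: "x \<ge> 1/4 \<Longrightarrow> \<bar>theta_deriv x\<bar> \<le> 8 * exp (- 4 * x)"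
proof -
  assume x: "x \<ge> 1/4"
  have "\<bar>theta_deriv x\<bar> \<le> exp (- 4 * x) / x * (1 + 1 / (4 * x))"
    using x by (intro abs_theta_deriv_le) auto
  also have "\<dots> \<le> exp (- 4 * x) / (1/4) * 2"
    using x by (intro mult_mono divide_left_mono) (auto simp: field_simps)
  finally show ?thesis by simp
qed

lemma DERIV_theta:
  assumes "x > 0"
  shows   "(theta has_real_derivative theta_deriv x) (at x)"
proof -
  define a where "a = x / 2"
  have a: "0 < a" "a < x" using assms by (auto simp: a_def)
  have "((\<lambda>x. \<Sum>k. theta_term x k) has_real_derivative (\<Sum>k. theta_deriv_term x k)) (at x)"
  proof (rule has_field_derivative_series'(2)[where S = "{a<..}" and x0 = x])
    show "((\<lambda>x. theta_term x k) has_real_derivative theta_deriv_term y k) (at y within {a<..})" for k y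
      unfolding theta_term_def theta_deriv_term_def by (auto intro!: derivative_eq_intros)
    show "uniformly_convergent_on {a<..} (\<lambda>n x. \<Sum>k<n. theta_deriv_term x k)"
    proof (rule Weierstrass_m_test')
      show "summable (\<lambda>k. exp (- 4 * a) / a * exp (- (4 * a) * real k))"
        using a by (intro summable_mult summable_exp_minus_mult) auto
      show "norm (theta_deriv_term y k) \<le> exp (- 4 * a) / a * exp (- (4 * a) * real k)"
        if "y \<in> {a<..}" for k y
      proof -
        have "norm (theta_deriv_term y k) \<le> exp (- 4 * y) / y * exp (- (4 * y) * real k)"
          using theta_deriv_term_le[of y k] that a by simp
        also have "\<dots> \<le> exp (- 4 * a) / a * exp (- (4 * a) * real k)"
          using that a by (intro mult_mono frac_le) (auto intro!: mult_right_mono)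
        finally show ?thesis .
      qed
    qed
  qed (use a summable_theta_term in \<open>auto simp: interior_open\<close>)
  then show ?thesis
    by (simp add: theta_def[abs_def] theta_deriv_def)
qed

text \<open>The normalisation of the theta function that has a limit at \<open>0\<close>.\<close>

definition theta_scaled :: "real \<Rightarrow> real" where
  "theta_scaled x = sqrt x * (1 + 2 * theta x)"

definition theta_scaled_deriv :: "real \<Rightarrow> real" where
  "theta_scaled_deriv x = (1 + 2 * theta x) / (2 * sqrt x) + 2 * sqrt x * theta_deriv x"

lemma DERIV_theta_scaled:
  "x > 0 \<Longrightarrow> (theta_scaled has_real_derivative theta_scaled_deriv x) (at x)"
  unfolding theta_scaled_def[abs_def] theta_scaled_deriv_def
  by (auto intro!: derivative_eq_intros DERIV_theta simp: field_simps)

text \<open>The polynomial \<open>[:0, 1:]\<close> stands for \<open>y * exp (- y^2)\<close>, whose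
  derivative has the polynomial \<open>1 - 2 * y^2\<close> that arises from differentiating
  \<open>sqrt x * exp (- (pi * sqrt x * k)^2)\<close> in \<open>x\<close>.\<close>

lemma theta_scaled_deriv_eq_gauss_sum:
  assumes "x > 0"
  shows   "theta_scaled_deriv x = gauss_sum (gauss_deriv [:0, 1:]) (pi * sqrt x) 0 / (2 * sqrt x)"
proof -
  \<comment> \<open>At \<open>u = 0\<close> the folded sum pairs the lattice points \<open>k\<close>
    and \<open>- (k + 1)\<close>. The summand is even, so the pair contributes
    \<open>a k + a (Suc k)\<close>, and the total is \<open>a 0\<close> plus twice the sum over
    positive \<open>k\<close>.\<close>
  define a where "a = (\<lambda>k::nat. gauss [:1, 0, -2:] (pi * sqrt x * real k))"
  have p: "gauss_deriv [:0, 1:] = [:1, 0, -2:]"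
    by (simp add: gauss_deriv_def pderiv_pCons)
  have "gauss_term [:1, 0, -2:] (pi * sqrt x) 0 k = a k + a (Suc k)" for k
    by (simp add: gauss_term_def a_def gauss_def power2_eq_square algebra_simps)
  moreover have "(\<lambda>k. theta_term x k + 2 * x * theta_deriv_term x k) sums (theta x + 2 * x * theta_deriv x)"
    unfolding theta_def theta_deriv_def
    by (intro sums_add sums_mult summable_sums summable_theta_term summable_theta_deriv_term assms)
  moreover have "a (Suc k) = theta_term x k + 2 * x * theta_deriv_term x k" for k
  proof -
    have sq: "(pi * sqrt x * real (Suc k))\<^sup>2 = pi\<^sup>2 * x * (real (Suc k))\<^sup>2"
      using assms by (simp add: power_mult_distrib)
    have p: "poly [:1, 0, -2:] y = 1 - 2 * y\<^sup>2" for y :: real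
      by (simp add: power2_eq_square)
    show ?thesis
      unfolding a_def gauss_def theta_term_def theta_deriv_term_def p sq by (simp add: left_diff_distrib)
  qed
  ultimately have 1: "(\<lambda>k. a (Suc k)) sums (theta x + 2 * x * theta_deriv x)"
    by simp
  then have "a sums (theta x + 2 * x * theta_deriv x + a 0)"
    by (rule sums_Suc)
  from sums_add[OF this 1]
  have "(\<lambda>k. a k + a (Suc k)) sums (1 + 2 * theta x + 4 * x * theta_deriv x)"
    by (simp add: a_def gauss_def algebra_simps)
  then have "gauss_sum [:1, 0, -2:] (pi * sqrt x) 0 = 1 + 2 * theta x + 4 * x * theta_deriv x"
    using \<open>\<And>k. gauss_term _ _ _ k = _\<close> by (simp add: gauss_sum_def sums_iff)
  then show ?thesis
    using assms by (simp add: p theta_scaled_deriv_def field_simps)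
qed

lemma theta_scaled_deriv_rapid:
  obtains C where "C > 0" "\<And>x. 0 < x \<Longrightarrow> x \<le> 4 \<Longrightarrow> \<bar>theta_scaled_deriv x\<bar> \<le> C * x ^ N"
proof -
  \<comment> \<open>With \<open>h = pi * sqrt x\<close>, the power \<open>h ^ (2 * N)\<close> yields
    \<open>x ^ N\<close>. The two remaining powers of \<open>h\<close> absorb the term
    \<open>1 / h\<close> and the division by \<open>2 * sqrt x\<close>.\<close>
  obtain C where C: "C > 0" "\<And>h. h > 0 \<Longrightarrow>
      \<bar>gauss_sum (gauss_deriv [:0, 1:]) h 0\<bar> \<le> C * h ^ (2 * N + 2) * (1 + 1 / h)"
    using gauss_sum_deriv_rapid[of "[:0, 1:]" "2 * N + 2"] by auto
  define D where "D = C * pi ^ (2 * N) * (pi\<^sup>2 * 2 + pi)"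
  have "D > 0"
    unfolding D_def using C(1) by (auto intro!: mult_pos_pos add_pos_pos)
  moreover have "\<bar>theta_scaled_deriv x\<bar> \<le> D * x ^ N" if x: "0 < x" "x \<le> 4" for x
  proof -
    define h where "h = pi * sqrt x"
    have h: "h > 0" using x by (simp add: h_def)
    have "sqrt x \<le> 2"
      using x real_sqrt_le_mono[of x 4] by simp
    have "\<bar>theta_scaled_deriv x\<bar> \<le> C * h ^ (2 * N + 2) * (1 + 1 / h) / (2 * sqrt x)"
      unfolding theta_scaled_deriv_eq_gauss_sum[OF x(1)] abs_divide h_def[symmetric]
      using x C(2)[OF h] by (auto intro!: divide_right_mono)
    also have "h ^ (2 * N + 2) * (1 + 1 / h) = h ^ (2 * N) * (h\<^sup>2 + h)"
      using h by (simp add: power_add field_simps power2_eq_square)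
    then have "C * h ^ (2 * N + 2) * (1 + 1 / h) = C * (h ^ (2 * N) * (h\<^sup>2 + h))"
      by (simp add: mult.assoc)
    also have "h ^ (2 * N) = pi ^ (2 * N) * x ^ N"
      using x by (simp add: h_def power_mult_distrib power_mult)
    also have "h\<^sup>2 + h = sqrt x * (pi\<^sup>2 * sqrt x + pi)"
      using x by (simp add: h_def power_mult_distrib algebra_simps power2_eq_square)
    also have "C * (pi ^ (2 * N) * x ^ N * (sqrt x * (pi\<^sup>2 * sqrt x + pi))) / (2 * sqrt x)
        = C * pi ^ (2 * N) * x ^ N * ((pi\<^sup>2 * sqrt x + pi) / 2)"
      using x by (simp add: field_simps)
    also have "\<dots> \<le> C * pi ^ (2 * N) * x ^ N * (pi\<^sup>2 * 2 + pi)"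
    proof -
      have "pi\<^sup>2 * sqrt x \<le> pi\<^sup>2 * 2" "0 \<le> pi\<^sup>2 * sqrt x"
        using \<open>sqrt x \<le> 2\<close> x by (auto intro!: mult_left_mono)
      moreover have half: "(a + c) / 2 \<le> b + c" if "a \<le> b" "0 \<le> a" "0 < c" for a b c :: real
        using that by (simp add: field_simps)
      ultimately have "(pi\<^sup>2 * sqrt x + pi) / 2 \<le> pi\<^sup>2 * 2 + pi"
        by (intro half pi_gt_zero)
      then show ?thesis using x C(1) by (intro mult_left_mono) auto
    qed
    finally show ?thesis by (simp add: D_def mult_ac)
  qed
  ultimately show ?thesis using that by blast
qed

text \<open>The bound \<open>b\<close> is kept free for two uses: \<open>b = 4\<close> gives a
  Lipschitz constant on the whole interval, and \<open>b = x\<close> keeps the factor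
  \<open>x ^ N\<close> when the second point tends to \<open>0\<close>.\<close>

lemma theta_scaled_diff_le:
  assumes C: "\<And>x. 0 < x \<Longrightarrow> x \<le> 4 \<Longrightarrow> \<bar>theta_scaled_deriv x\<bar> \<le> C * x ^ N" "C > 0"
  assumes xy: "0 < x" "x \<le> b" "0 < y" "y \<le> b" "b \<le> 4"
  shows   "\<bar>theta_scaled x - theta_scaled y\<bar> \<le> C * b ^ N * \<bar>x - y\<bar>"
proof -
  have "norm (theta_scaled x - theta_scaled y) \<le> C * b ^ N * norm (x - y)"
  proof (rule field_differentiable_bound[where S = "{0<..b}" and f' = theta_scaled_deriv])
    show "(theta_scaled has_real_derivative theta_scaled_deriv z) (at z within {0<..b})"
      if "z \<in> {0<..b}" for z
      by (rule has_field_derivative_at_within[OF DERIV_theta_scaled]) (use that in auto)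
    show "norm (theta_scaled_deriv z) \<le> C * b ^ N" if "z \<in> {0<..b}" for z
    proof -
      have "norm (theta_scaled_deriv z) \<le> C * z ^ N"
        using that xy C(1)[of z] by simp
      also have "\<dots> \<le> C * b ^ N"
        using that C(2) by (intro mult_left_mono power_mono) auto
      finally show ?thesis .
    qed
  qed (use xy in auto)
  then show ?thesis by simp
qed

section \<open>The limit constant and the singular part of the theta function at zero\<close>

definition theta_const :: real where
  "theta_const = lim (\<lambda>n. theta_scaled (inverse (real (Suc n))))"

text \<open>Exponent \<open>0\<close> in the derivative bound makes \<open>theta_scaled\<close>
  Lipschitz near \<open>0\<close>, so it maps the Cauchy sequence \<open>1 / (n + 1)\<close> to a
  Cauchy sequence.\<close>

lemma theta_scaled_LIMSEQ:
  "(\<lambda>n. theta_scaled (inverse (real (Suc n)))) \<longlonglongrightarrow> theta_const"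
proof -
  obtain C where C: "\<And>x. 0 < x \<Longrightarrow> x \<le> 4 \<Longrightarrow> \<bar>theta_scaled_deriv x\<bar> \<le> C * x ^ 0" "C > 0"
    using theta_scaled_deriv_rapid[of 0] by metis
  have "C-lipschitz_on {0<..4} theta_scaled"
    using C(2) theta_scaled_diff_le[OF C, of _ 4]
    by (intro lipschitz_onI) (auto simp: dist_real_def)
  then have "uniformly_continuous_on {0<..4} theta_scaled"
    by (rule lipschitz_on_uniformly_continuous)
  moreover have "Cauchy (\<lambda>n. inverse (real (Suc n)))"
    by (rule LIMSEQ_imp_Cauchy[OF LIMSEQ_inverse_real_of_nat])
  moreover have "inverse (real (Suc n)) \<in> {0<..4}" for n
    by (auto simp: field_simps)
  ultimately have "Cauchy (\<lambda>n. theta_scaled (inverse (real (Suc n))))"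
    by (rule uniformly_continuous_on_Cauchy)
  then show ?thesis
    unfolding theta_const_def by (simp add: Cauchy_convergent_iff convergent_LIMSEQ_iff)
qed

text \<open>Let the second point of \<open>theta_scaled_diff_le\<close> run through
  \<open>1 / (n + 1)\<close> with \<open>b = x\<close>; the distance of the two points is at most
  \<open>x\<close>, hence at most \<open>4\<close>.\<close>

lemma theta_scaled_rapid:
  obtains C where "C > 0" "\<And>x. 0 < x \<Longrightarrow> x \<le> 4 \<Longrightarrow> \<bar>theta_scaled x - theta_const\<bar> \<le> C * x ^ N"
proof -
  obtain C where C: "\<And>x. 0 < x \<Longrightarrow> x \<le> 4 \<Longrightarrow> \<bar>theta_scaled_deriv x\<bar> \<le> C * x ^ N" "C > 0"
    using theta_scaled_deriv_rapid[of N] by metis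
  have "\<bar>theta_scaled x - theta_const\<bar> \<le> (C * 4) * x ^ N" if x: "0 < x" "x \<le> 4" for x
  proof (rule tendsto_upperbound)
    show "(\<lambda>n. \<bar>theta_scaled x - theta_scaled (inverse (real (Suc n)))\<bar>)
            \<longlonglongrightarrow> \<bar>theta_scaled x - theta_const\<bar>"
      by (intro tendsto_intros theta_scaled_LIMSEQ)
    have "eventually (\<lambda>n. inverse (real (Suc n)) < x) sequentially"
      using order_tendstoD(2)[OF LIMSEQ_inverse_real_of_nat x(1)] .
    then show "eventually (\<lambda>n. \<bar>theta_scaled x - theta_scaled (inverse (real (Suc n)))\<bar>
                 \<le> (C * 4) * x ^ N) sequentially"
    proof eventually_elim
      case (elim n)
      have "\<bar>theta_scaled x - theta_scaled (inverse (real (Suc n)))\<bar>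
              \<le> C * x ^ N * \<bar>x - inverse (real (Suc n))\<bar>"
        using x elim by (intro theta_scaled_diff_le C) auto
      also have "\<bar>x - inverse (real (Suc n))\<bar> \<le> x"
        using elim by (simp add: abs_if)
      then have "C * x ^ N * \<bar>x - inverse (real (Suc n))\<bar> \<le> C * x ^ N * 4"
        using x C(2) by (intro mult_left_mono) auto
      finally show ?case by (simp add: mult_ac)
    qed
  qed auto
  then show ?thesis using that[of "C * 4"] C(2) by simp
qed

text \<open>The solution \<open>y\<close> of \<open>sqrt x * (1 + 2 * y) = theta_const\<close>. By
  Jacobi's transformation formula the constant is \<open>1 / sqrt pi\<close>.\<close>

definition theta_main :: "real \<Rightarrow> real" where
  "theta_main x = theta_const / (2 * sqrt x) - 1 / 2"

definition theta_main_deriv :: "real \<Rightarrow> real" where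
  "theta_main_deriv x = - theta_const / (4 * x * sqrt x)"

lemma DERIV_theta_main: "x > 0 \<Longrightarrow> (theta_main has_real_derivative theta_main_deriv x) (at x)"
  unfolding theta_main_def[abs_def] theta_main_deriv_def
  by (auto intro!: derivative_eq_intros simp: field_simps power2_eq_square)

text \<open>Both differences are combinations of \<open>theta_scaled x - theta_const\<close> and
  \<open>theta_scaled_deriv x\<close>, divided by multiples of \<open>sqrt x\<close> or
  \<open>x * sqrt x\<close>. Two spare powers of \<open>x\<close> pay for these divisions.\<close>

lemma theta_diff_main_rapid:
  obtains C where "C > 0" "\<And>x. 0 < x \<Longrightarrow> x \<le> 4 \<Longrightarrow> \<bar>theta x - theta_main x\<bar> \<le> C * x ^ N"
    "\<And>x. 0 < x \<Longrightarrow> x \<le> 4 \<Longrightarrow> \<bar>theta_deriv x - theta_main_deriv x\<bar> \<le> C * x ^ N"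
proof -
  obtain C1 where C1: "C1 > 0" "\<And>x. 0 < x \<Longrightarrow> x \<le> 4 \<Longrightarrow> \<bar>theta_scaled x - theta_const\<bar> \<le> C1 * x ^ (N + 2)"
    using theta_scaled_rapid by blast
  obtain C2 where C2: "C2 > 0" "\<And>x. 0 < x \<Longrightarrow> x \<le> 4 \<Longrightarrow> \<bar>theta_scaled_deriv x\<bar> \<le> C2 * x ^ (N + 2)"
    using theta_scaled_deriv_rapid by blast
  define C where "C = 16 * (C1 + C2)"
  have bound: "D * x ^ (N + 2) / sqrt x \<le> 8 * D * x ^ N"
       "D * x ^ (N + 2) / (x * sqrt x) \<le> 2 * D * x ^ N"
    if "0 < x" "x \<le> 4" "D > 0" for x D
  proof -
    have s: "sqrt x \<le> 2"
      using that real_sqrt_le_mono[of x 4] by simp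
    have "D * x ^ (N + 2) / sqrt x = D * x ^ N * (x * sqrt x)"
      using that by (simp add: field_simps power2_eq_square)
    also have "\<dots> \<le> D * x ^ N * (4 * 2)"
      using that s by (intro mult_left_mono mult_mono) auto
    finally show "D * x ^ (N + 2) / sqrt x \<le> 8 * D * x ^ N" by simp
    have "D * x ^ (N + 2) / (x * sqrt x) = D * x ^ N * sqrt x"
      using that by (simp add: field_simps power2_eq_square)
    also have "\<dots> \<le> D * x ^ N * 2"
      using that s by (intro mult_left_mono) auto
    finally show "D * x ^ (N + 2) / (x * sqrt x) \<le> 2 * D * x ^ N" by simp
  qed
  have A: "\<bar>theta x - theta_main x\<bar> \<le> C * x ^ N" if x: "0 < x" "x \<le> 4" for x
  proof -
    have "theta x - theta_main x = (theta_scaled x - theta_const) / (2 * sqrt x)"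
      using x by (simp add: theta_scaled_def theta_main_def field_simps)
    also have "\<bar>\<dots>\<bar> \<le> C1 * x ^ (N + 2) / (2 * sqrt x)"
      unfolding abs_divide using C1(2)[OF x] x by (auto intro!: divide_right_mono)
    also have "\<dots> \<le> 8 * C1 * x ^ N"
      by (rule order_trans[OF divide_left_mono bound(1)[OF x C1(1)]]) (use x C1(1) in auto)
    also have "\<dots> \<le> C * x ^ N"
      using C1 C2 x by (intro mult_right_mono) (auto simp: C_def)
    finally show ?thesis .
  qed
  have B: "\<bar>theta_deriv x - theta_main_deriv x\<bar> \<le> C * x ^ N" if x: "0 < x" "x \<le> 4" for x
  proof -
    have [simp]: "sqrt x * (sqrt x * y) = x * y" for y
      using x by (simp add: mult.assoc[symmetric])
    have "theta_deriv x - theta_main_deriv x =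
            theta_scaled_deriv x / (2 * sqrt x) - (theta_scaled x - theta_const) / (4 * x * sqrt x)"
      using x by (simp add: theta_scaled_def theta_scaled_deriv_def theta_main_deriv_def field_simps)
    also have "\<bar>\<dots>\<bar> \<le> \<bar>theta_scaled_deriv x / (2 * sqrt x)\<bar> + \<bar>(theta_scaled x - theta_const) / (4 * x * sqrt x)\<bar>"
      by (rule abs_triangle_ineq4)
    also have "\<bar>theta_scaled_deriv x / (2 * sqrt x)\<bar> \<le> C2 * x ^ (N + 2) / (2 * sqrt x)"
      unfolding abs_divide using C2(2)[OF x] x by (auto intro!: divide_right_mono)
    also have "\<bar>(theta_scaled x - theta_const) / (4 * x * sqrt x)\<bar> \<le> C1 * x ^ (N + 2) / (4 * x * sqrt x)"
      by (rule order_trans[OF _ divide_right_mono[OF C1(2)[OF x]]]) (use x in \<open>auto simp: abs_mult\<close>)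
    also have "C2 * x ^ (N + 2) / (2 * sqrt x) \<le> 8 * C2 * x ^ N"
      by (rule order_trans[OF divide_left_mono bound(1)[OF x C2(1)]]) (use x C2(1) in auto)
    also have "C1 * x ^ (N + 2) / (4 * x * sqrt x) \<le> 2 * C1 * x ^ N"
      by (rule order_trans[OF divide_left_mono bound(2)[OF x C1(1)]]) (use x C1(1) in auto)
    also have "8 * C2 * x ^ N + 2 * C1 * x ^ N \<le> C * x ^ N"
      unfolding distrib_right[symmetric] using C1 C2 x by (intro mult_right_mono) (auto simp: C_def)
    finally show ?thesis by simp
  qed
  show ?thesis
    using that[of C] A B C1 C2 by (simp add: C_def)
qed

section \<open>Mellin transforms of rapidly decaying functions\<close>

text \<open>On the convex set \<open>U\<close> the mean value inequality bounds all difference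
  quotients by \<open>g\<close>, and dominated convergence applies along every sequence tending to
  \<open>z0\<close>. The field is left general: the parameter is the complex \<open>s\<close> of a
  Mellin transform in one application and the real side length \<open>t\<close> in another.\<close>

lemma has_field_derivative_integral_parameter:
  fixes f f' :: "'a::{real_normed_field, banach, second_countable_topology} \<Rightarrow> 'b \<Rightarrow> 'a"
  assumes U: "open U" "convex U" "z0 \<in> U"
    and deriv: "\<And>z x. z \<in> U \<Longrightarrow> x \<in> space M \<Longrightarrow> ((\<lambda>z. f z x) has_field_derivative f' z x) (at z)"
    and bound: "\<And>z x. z \<in> U \<Longrightarrow> x \<in> space M \<Longrightarrow> norm (f' z x) \<le> g x"
    and int: "\<And>z. z \<in> U \<Longrightarrow> integrable M (f z)"
    and meas: "f' z0 \<in> borel_measurable M"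
    and g: "integrable M g"
  shows "((\<lambda>z. \<integral>x. f z x \<partial>M) has_field_derivative (\<integral>x. f' z0 x \<partial>M)) (at z0)"
proof -
  have "((\<lambda>y. ((\<integral>x. f y x \<partial>M) - (\<integral>x. f z0 x \<partial>M)) / (y - z0)) \<longlongrightarrow> (\<integral>x. f' z0 x \<partial>M)) (at z0 within U)"
    unfolding tendsto_at_iff_sequentially o_def
  proof (intro allI impI)
    fix X :: "nat \<Rightarrow> 'a" assume X: "\<forall>i. X i \<in> U - {z0}" "X \<longlonglongrightarrow> z0"
    have "(\<lambda>i. \<integral>x. (f (X i) x - f z0 x) / (X i - z0) \<partial>M) \<longlonglongrightarrow> (\<integral>x. f' z0 x \<partial>M)"
    proof (rule integral_dominated_convergence[where w = g])
      show "(\<lambda>x. (f (X i) x - f z0 x) / (X i - z0)) \<in> borel_measurable M" for i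
        using int[of "X i"] int[of z0] X(1) U(3) by auto
      show "AE x in M. (\<lambda>i. (f (X i) x - f z0 x) / (X i - z0)) \<longlonglongrightarrow> f' z0 x"
      proof (rule AE_I2)
        fix x assume "x \<in> space M"
        then have "((\<lambda>y. (f y x - f z0 x) / (y - z0)) \<longlongrightarrow> f' z0 x) (at z0)"
          using deriv[OF U(3)] by (simp add: has_field_derivative_iff)
        then show "(\<lambda>i. (f (X i) x - f z0 x) / (X i - z0)) \<longlonglongrightarrow> f' z0 x"
          using X by (auto simp: tendsto_at_iff_sequentially o_def)
      qed
      show "AE x in M. norm ((f (X i) x - f z0 x) / (X i - z0)) \<le> g x" for i
      proof (rule AE_I2)
        fix x assume x: "x \<in> space M"
        have "norm (f (X i) x - f z0 x) \<le> g x * norm (X i - z0)"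
          by (rule field_differentiable_bound[OF U(2), where f' = "\<lambda>z. f' z x"])
             (use x X(1) U bound deriv in \<open>auto intro!: has_field_derivative_at_within[OF deriv]\<close>)
        then show "norm ((f (X i) x - f z0 x) / (X i - z0)) \<le> g x"
          using X(1) by (simp add: norm_divide divide_le_eq)
      qed
    qed (use meas g in auto)
    moreover have "(\<integral>x. (f (X i) x - f z0 x) / (X i - z0) \<partial>M) =
        ((\<integral>x. f (X i) x \<partial>M) - (\<integral>x. f z0 x \<partial>M)) / (X i - z0)" for i
      using X(1) U(3) by (simp add: Bochner_Integration.integral_diff int)
    ultimately show "(\<lambda>i. ((\<integral>x. f (X i) x \<partial>M) - (\<integral>x. f z0 x \<partial>M)) / (X i - z0)) \<longlonglongrightarrow> (\<integral>x. f' z0 x \<partial>M)"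
      by (simp only:)
  qed
  then show ?thesis
    unfolding has_field_derivative_iff at_within_open[OF U(3,1)] .
qed

text \<open>Arbitrary powers of \<open>x\<close> tame every \<open>x powr (s - 1)\<close> at
  \<open>0\<close>, and \<open>exp (- x)\<close> does so at infinity, so the Mellin transform is
  entire. The indicator discards the values at \<open>x \<le> 0\<close>, where the theta series
  carry no meaning.\<close>

definition rapid :: "(real \<Rightarrow> real) \<Rightarrow> bool" where
  "rapid G \<longleftrightarrow> (\<lambda>x. indicator {0<..} x * G x) \<in> borel_measurable borel \<and>
     (\<forall>N. \<exists>C>0. \<forall>x>0. \<bar>G x\<bar> \<le> C * x ^ N * exp (- x))"

definition mellin :: "(real \<Rightarrow> real) \<Rightarrow> complex \<Rightarrow> complex" where
  "mellin G s = (\<integral>x. indicator {0<..} x *\<^sub>R (of_real x powr (s - 1) * of_real (G x)) \<partial>lborel)"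

lemma integrable_indicator_exp:
  fixes c :: real
  assumes "c > 0"
  shows   "integrable lborel (\<lambda>x. indicator {0<..} x * exp (- c * x))"
proof -
  have "(\<lambda>x. exp (- c * x)) absolutely_integrable_on {0..}"
    using has_integral_exp_minus_to_infinity[OF assms, of 0]
    by (intro nonnegative_absolutely_integrable_1) (auto simp: has_integral_iff)
  then have "(\<lambda>x. exp (- c * x)) absolutely_integrable_on {0<..}"
    by (rule set_integrable_subset) auto
  then have "integrable lebesgue (\<lambda>x. indicator {0<..} x *\<^sub>R exp (- c * x))"
    by (simp add: set_integrable_def)
  then show ?thesis
    by (subst (asm) integrable_completion) auto
qed

lemma powr_le_one_plus_power:
  fixes x c :: real
  assumes "x > 0" "0 \<le> c" "c \<le> real n"
  shows   "x powr c \<le> (1 + x) ^ n"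
proof -
  have "x powr c \<le> (1 + x) powr c"
    using assms by (intro powr_mono2) auto
  also have "\<dots> \<le> (1 + x) powr real n"
    using assms by (intro powr_mono) auto
  finally show ?thesis
    using assms by (simp add: powr_realpow)
qed

lemma abs_ln_le: "x > 0 \<Longrightarrow> \<bar>ln x\<bar> \<le> x + 1 / x" for x :: real
proof -
  assume x: "x > 0"
  have "ln x \<le> x" "- ln x \<le> 1 / x"
    using ln_bound[of x] ln_bound[of "1 / x"] x by (auto simp: ln_div)
  moreover have "0 < 1 / x"
    using x by simp
  ultimately show ?thesis
    using x by (auto simp: abs_le_iff intro: add_increasing add_increasing2)
qed

text \<open>One constant serves all exponents \<open>a\<close> in \<open>[-K, K]\<close>, hence all
  \<open>s\<close> in a ball. The version with \<open>ln x\<close> dominates the derivative of the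
  Mellin integrand in \<open>s\<close>.\<close>

lemma rapid_powr_bound:
  assumes "rapid G"
  obtains D where "\<And>x a. x > 0 \<Longrightarrow> \<bar>a\<bar> \<le> real K \<Longrightarrow> x powr a * \<bar>G x\<bar> \<le> D * exp (- (1/2) * x)"
    "\<And>x a. x > 0 \<Longrightarrow> \<bar>a\<bar> \<le> real K \<Longrightarrow> \<bar>ln x\<bar> * (x powr a * \<bar>G x\<bar>) \<le> D * exp (- (1/2) * x)"
proof -
  obtain C where C: "C > 0" "\<And>x. x > 0 \<Longrightarrow> \<bar>G x\<bar> \<le> C * x ^ Suc K * exp (- x)"
    using assms unfolding rapid_def by meson
  \<comment> \<open>Multiplication by \<open>x ^ Suc K\<close> moves the exponent \<open>a\<close>
    into \<open>[1, 2 * K + 1]\<close>; the bound \<open>x + 1 / x\<close> for the logarithm moves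
    it by one either way, so \<open>[0, 2 * K + 2]\<close> suffices.\<close>
  define n where "n = 2 * K + 2"
  define D where "D = 2 * C * (fact n * 2 ^ n * exp (1/2))"
  have poly: "(1 + x) ^ n * exp (- x) \<le> fact n * 2 ^ n * exp (1/2) * exp (- (1/2) * x)" if "x > 0" for x :: real
  proof -
    \<comment> \<open>Halving the argument spends only \<open>exp (x / 2)\<close>, so that
      \<open>exp (- x / 2)\<close> survives.\<close>
    have "((1 + x) / 2) ^ n \<le> fact n * exp ((1 + x) / 2)"
      using that by (intro power_le_fact_mult_exp) auto
    then have "(1 + x) ^ n \<le> fact n * 2 ^ n * exp ((1 + x) / 2)"
      by (simp add: power_divide field_simps)
    then have "(1 + x) ^ n * exp (- x) \<le> fact n * 2 ^ n * exp ((1 + x) / 2) * exp (- x)"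
      by (intro mult_right_mono) auto
    also have "\<dots> = fact n * 2 ^ n * exp ((1 + x) / 2 + - x)"
      by (simp only: exp_add mult.assoc)
    also have "(1 + x) / 2 + - x = 1/2 + - (1/2) * x"
      by (simp add: field_simps)
    finally show ?thesis
      by (simp only: exp_add mult.assoc)
  qed
  have main: "b * \<bar>G x\<bar> \<le> D * exp (- (1/2) * x)"
    if x: "x > 0" and b: "0 \<le> b" "b * x ^ Suc K \<le> 2 * (1 + x) ^ n" for x b :: real
  proof -
    have "b * \<bar>G x\<bar> \<le> b * (C * x ^ Suc K * exp (- x))"
      using C(2)[OF x] b(1) by (intro mult_left_mono) auto
    also have "\<dots> = C * exp (- x) * (b * x ^ Suc K)"
      by simp
    also have "\<dots> \<le> C * exp (- x) * (2 * (1 + x) ^ n)"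
      using C(1) b(2) by (intro mult_left_mono) auto
    also have "\<dots> = 2 * C * ((1 + x) ^ n * exp (- x))"
      by simp
    also have "\<dots> \<le> 2 * C * (fact n * 2 ^ n * exp (1/2) * exp (- (1/2) * x))"
      using C(1) poly[OF x] by (intro mult_left_mono) auto
    finally show ?thesis
      by (simp add: D_def mult.assoc)
  qed
  have *: "x powr a * x ^ Suc K = x powr (a + real (Suc K))" if "x > 0" for x a :: real
    using that by (simp add: powr_add powr_realpow del: of_nat_Suc power_Suc)
  show ?thesis
  proof (rule that)
    fix x a :: real assume x: "x > 0" and a: "\<bar>a\<bar> \<le> real K"
    have "x powr (a + real (Suc K)) \<le> (1 + x) ^ n"
      using x a by (intro powr_le_one_plus_power) (auto simp: n_def)
    also have "\<dots> \<le> 2 * (1 + x) ^ n"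
      using x by simp
    finally have "x powr (a + real (Suc K)) \<le> 2 * (1 + x) ^ n" .
    then show "x powr a * \<bar>G x\<bar> \<le> D * exp (- (1/2) * x)"
      using x by (intro main) (auto simp: *[OF x] simp del: power_Suc of_nat_Suc)
    have "\<bar>ln x\<bar> * (x powr a * x ^ Suc K) \<le> (x + 1 / x) * (x powr a * x ^ Suc K)"
      using x by (intro mult_right_mono abs_ln_le) auto
    also have "\<dots> = x powr (a + real (Suc K) + 1) + x powr (a + real (Suc K) - 1)"
      unfolding *[OF x] using x by (simp add: powr_add powr_diff field_simps power2_eq_square)
    also have "\<dots> \<le> (1 + x) ^ n + (1 + x) ^ n"
      using x a by (intro add_mono powr_le_one_plus_power) (auto simp: n_def)
    finally have "(\<bar>ln x\<bar> * x powr a) * x ^ Suc K \<le> 2 * (1 + x) ^ n"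
      by (simp add: mult.assoc)
    from main[OF x _ this]
    show "\<bar>ln x\<bar> * (x powr a * \<bar>G x\<bar>) \<le> D * exp (- (1/2) * x)"
      using x by (simp add: mult.assoc)
  qed
qed

lemma borel_measurable_powr_indicator:
  assumes "(\<lambda>x. indicator {0<..} x * G x) \<in> borel_measurable borel"
  shows   "(\<lambda>x. indicator {0<..} x *\<^sub>R (complex_of_real x powr s * of_real (G x))) \<in> borel_measurable borel"
proof -
  have "(\<lambda>x. indicator {0<..} x *\<^sub>R (complex_of_real x powr s)) \<in> borel_measurable borel"
    by (intro borel_measurable_continuous_on_indicator continuous_intros) auto
  then have "(\<lambda>x. indicator {0<..} x *\<^sub>R (complex_of_real x powr s) *
               of_real (indicator {0<..} x * G x)) \<in> borel_measurable borel"
    using assms by (intro borel_measurable_times measurable_compose[OF assms borel_measurable_of_real])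
  also have "(\<lambda>x. indicator {0<..} x *\<^sub>R (complex_of_real x powr s) * of_real (indicator {0<..} x * G x)) =
             (\<lambda>x. indicator {0<..} x *\<^sub>R (complex_of_real x powr s * of_real (G x)))"
    by (auto simp: fun_eq_iff indicator_def)
  finally show ?thesis .
qed

lemma integrable_mellin:
  assumes "rapid G"
  shows   "integrable lborel (\<lambda>x. indicator {0<..} x *\<^sub>R (complex_of_real x powr s * of_real (G x)))"
proof -
  define K where "K = nat \<lceil>\<bar>Re s\<bar>\<rceil>"
  have K: "\<bar>Re s\<bar> \<le> real K"
    unfolding K_def by linarith
  obtain D where D: "\<And>x a. x > 0 \<Longrightarrow> \<bar>a\<bar> \<le> real K \<Longrightarrow> x powr a * \<bar>G x\<bar> \<le> D * exp (- (1/2) * x)"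
    using rapid_powr_bound[OF assms, of K] by metis
  show ?thesis
  proof (rule Bochner_Integration.integrable_bound)
    show "integrable lborel (\<lambda>x. D * (indicator {0<..} x * exp (- (1/2) * x)))"
      by (intro integrable_mult_right integrable_indicator_exp) auto
    show "(\<lambda>x. indicator {0<..} x *\<^sub>R (complex_of_real x powr s * of_real (G x))) \<in> borel_measurable lborel"
      using borel_measurable_powr_indicator[of G] assms by (simp add: rapid_def)
    show "AE x in lborel. norm (indicator {0<..} x *\<^sub>R (complex_of_real x powr s * of_real (G x)))
            \<le> norm (D * (indicator {0<..} x * exp (- (1/2) * x)))"
    proof (intro AE_I2)
      fix x :: real
      show "norm (indicator {0<..} x *\<^sub>R (complex_of_real x powr s * of_real (G x)))
            \<le> norm (D * (indicator {0<..} x * exp (- (1/2) * x)))"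
      proof (cases "x > 0")
        case True
        then have "norm (complex_of_real x powr s * of_real (G x)) = x powr Re s * \<bar>G x\<bar>"
          by (simp add: norm_mult norm_powr_real_powr)
        also have "\<dots> \<le> \<bar>D * exp (- (1/2) * x)\<bar>"
          using D[OF True K] by linarith
        finally show ?thesis using True by simp
      qed auto
    qed
  qed
qed

lemma holomorphic_mellin:
  assumes "rapid G"
  shows   "mellin G holomorphic_on A"
proof (rule holomorphic_onI)
  fix s assume "s \<in> A"
  \<comment> \<open>For \<open>z\<close> in the unit ball around \<open>s\<close>, the distance of
    \<open>Re z\<close> from \<open>1\<close> is below \<open>\<bar>Re s\<bar> + 2\<close>.\<close>
  define K where "K = nat \<lceil>\<bar>Re s\<bar> + 2\<rceil>"
  have K: "\<bar>Re z - 1\<bar> \<le> real K" if "z \<in> ball s 1" for z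
  proof -
    have "\<bar>Re s - Re z\<bar> < 1"
      using that abs_Re_le_cmod[of "s - z"] by (simp add: dist_norm)
    then show ?thesis unfolding K_def by linarith
  qed
  obtain D where D: "\<And>x a. x > 0 \<Longrightarrow> \<bar>a\<bar> \<le> real K \<Longrightarrow> \<bar>ln x\<bar> * (x powr a * \<bar>G x\<bar>) \<le> D * exp (- (1/2) * x)"
    using rapid_powr_bound[OF assms, of K] by metis
  have "(mellin G has_field_derivative
          (\<integral>x. indicator {0<..} x *\<^sub>R (complex_of_real x powr (s - 1) * of_real (ln x * G x)) \<partial>lborel)) (at s)"
    unfolding mellin_def[abs_def]
  proof (rule has_field_derivative_integral_parameter[where U = "ball s 1" and
           g = "\<lambda>x. D * (indicator {0<..} x * exp (- (1/2) * x))" and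
           f' = "\<lambda>s x. indicator {0<..} x *\<^sub>R (complex_of_real x powr (s - 1) * of_real (ln x * G x))"])
    fix z :: complex and x :: real
    assume z: "z \<in> ball s 1"
    show "((\<lambda>z. indicator {0<..} x *\<^sub>R (complex_of_real x powr (z - 1) * of_real (G x))) has_field_derivative
             indicator {0<..} x *\<^sub>R (complex_of_real x powr (z - 1) * of_real (ln x * G x))) (at z)"
    proof (cases "x > 0")
      case True
      have "((\<lambda>z. complex_of_real x powr (z - 1)) has_field_derivative
              Ln (complex_of_real x) * complex_of_real x powr (z - 1) * 1) (at z)"
        by (rule DERIV_chain2[OF has_field_derivative_powr_right])
           (use True in \<open>auto intro!: derivative_eq_intros\<close>)
      from DERIV_cmult_right[OF this, of "of_real (G x)"] show ?thesis
        using True by (simp add: Ln_of_real mult_ac)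
    qed auto
    show "norm (indicator {0<..} x *\<^sub>R (complex_of_real x powr (z - 1) * of_real (ln x * G x)))
           \<le> D * (indicator {0<..} x * exp (- (1/2) * x))"
    proof (cases "x > 0")
      case True
      then have "norm (complex_of_real x powr (z - 1) * of_real (ln x * G x)) = \<bar>ln x\<bar> * (x powr (Re z - 1) * \<bar>G x\<bar>)"
        by (simp add: norm_mult norm_powr_real_powr)
      also have "\<dots> \<le> D * exp (- (1/2) * x)"
        by (rule D[OF True K[OF z]])
      finally show ?thesis using True by simp
    qed auto
  next
    fix z :: complex assume z: "z \<in> ball s 1"
    show "integrable lborel (\<lambda>x. indicator {0<..} x *\<^sub>R (complex_of_real x powr (z - 1) * of_real (G x)))"
      by (rule integrable_mellin[OF assms])
  next
    have [measurable]: "(\<lambda>x. indicator {0<..} x * G x) \<in> borel_measurable borel"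
      using assms unfolding rapid_def by blast
    have "(\<lambda>x. ln x * (indicator {0<..} x * G x)) \<in> borel_measurable borel"
      by measurable
    then have "(\<lambda>x. indicator {0<..} x * (ln x * G x)) \<in> borel_measurable borel"
      by (simp only: mult.left_commute)
    from borel_measurable_powr_indicator[OF this]
    show "(\<lambda>x. indicator {0<..} x *\<^sub>R (complex_of_real x powr (s - 1) * of_real (ln x * G x)))
            \<in> borel_measurable lborel"
      by simp
    show "integrable lborel (\<lambda>x. D * (indicator {0<..} x * exp (- (1/2) * x)))"
      by (intro integrable_mult_right integrable_indicator_exp) auto
  qed auto
  then show "mellin G field_differentiable at s within A"
    using field_differentiable_at_within field_differentiable_def by blast
qed

section \<open>The heat trace of a box\<close>

text \<open>The range \<open>[1/2, 2]\<close> of the side length \<open>t\<close> is a neighbourhood of the equilateral value \<open>1\<close>.\<close>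

definition unif_rapid :: "(real \<Rightarrow> real \<Rightarrow> real) \<Rightarrow> bool" where
  "unif_rapid f \<longleftrightarrow> (\<forall>N. \<exists>C\<ge>0. \<forall>t\<in>{1/2..2}. \<forall>x\<in>{0<..1}. \<bar>f t x\<bar> \<le> C * x ^ N)"

text \<open>At most polynomial growth in \<open>1 / x\<close> at \<open>0\<close>, with the power
  multiplied out so that no negative exponents occur. Such factors preserve
  \<open>unif_rapid\<close>.\<close>

definition unif_tempered :: "(real \<Rightarrow> real \<Rightarrow> real) \<Rightarrow> bool" where
  "unif_tempered f \<longleftrightarrow> (\<exists>N. \<exists>C\<ge>0. \<forall>t\<in>{1/2..2}. \<forall>x\<in>{0<..1}. \<bar>f t x\<bar> * x ^ N \<le> C)"

lemma unif_rapid_add: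
  assumes "unif_rapid f" "unif_rapid g"
  shows   "unif_rapid (\<lambda>t x. f t x + g t x)"
  unfolding unif_rapid_def
proof
  fix N
  obtain C where C: "C \<ge> 0" "\<And>t x. t \<in> {1/2..2} \<Longrightarrow> x \<in> {0<..1} \<Longrightarrow> \<bar>f t x\<bar> \<le> C * x ^ N"
    using assms(1) unfolding unif_rapid_def by meson
  obtain D where D: "D \<ge> 0" "\<And>t x. t \<in> {1/2..2} \<Longrightarrow> x \<in> {0<..1} \<Longrightarrow> \<bar>g t x\<bar> \<le> D * x ^ N"
    using assms(2) unfolding unif_rapid_def by meson
  have "\<bar>f t x + g t x\<bar> \<le> (C + D) * x ^ N" if "t \<in> {1/2..2}" "x \<in> {0<..1}" for t x
    using C(2)[OF that] D(2)[OF that] by (simp add: distrib_right)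
  then show "\<exists>C\<ge>0. \<forall>t\<in>{1/2..2}. \<forall>x\<in>{0<..1}. \<bar>f t x + g t x\<bar> \<le> C * x ^ N"
    using C(1) D(1) by (intro exI[of _ "C + D"]) auto
qed

lemma unif_rapid_mult_tempered:
  assumes "unif_rapid f" "unif_tempered g"
  shows   "unif_rapid (\<lambda>t x. f t x * g t x)"
  unfolding unif_rapid_def
proof
  fix N
  obtain M D where D: "D \<ge> 0" "\<And>t x. t \<in> {1/2..2} \<Longrightarrow> x \<in> {0<..1} \<Longrightarrow> \<bar>g t x\<bar> * x ^ M \<le> D"
    using assms(2) unfolding unif_tempered_def by meson
  obtain C where C: "C \<ge> 0" "\<And>t x. t \<in> {1/2..2} \<Longrightarrow> x \<in> {0<..1} \<Longrightarrow> \<bar>f t x\<bar> \<le> C * x ^ (N + M)"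
    using assms(1) unfolding unif_rapid_def by meson
  have "\<bar>f t x * g t x\<bar> \<le> C * D * x ^ N" if "t \<in> {1/2..2}" "x \<in> {0<..1}" for t x
  proof -
    have "\<bar>f t x * g t x\<bar> \<le> C * x ^ (N + M) * \<bar>g t x\<bar>"
      unfolding abs_mult using C(2)[OF that] by (intro mult_right_mono) auto
    also have "\<dots> = C * x ^ N * (\<bar>g t x\<bar> * x ^ M)"
      by (simp add: power_add mult_ac)
    also have "\<dots> \<le> C * x ^ N * D"
      using D(2)[OF that] C(1) that by (intro mult_left_mono) auto
    finally show ?thesis by (simp add: mult_ac)
  qed
  then show "\<exists>C\<ge>0. \<forall>t\<in>{1/2..2}. \<forall>x\<in>{0<..1}. \<bar>f t x * g t x\<bar> \<le> C * x ^ N"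
    using C(1) D(1) by (intro exI[of _ "C * D"]) auto
qed

lemma unif_tempered_mult:
  assumes "unif_tempered f" "unif_tempered g"
  shows   "unif_tempered (\<lambda>t x. f t x * g t x)"
proof -
  obtain N C where C: "C \<ge> 0" "\<And>t x. t \<in> {1/2..2} \<Longrightarrow> x \<in> {0<..1} \<Longrightarrow> \<bar>f t x\<bar> * x ^ N \<le> C"
    using assms(1) unfolding unif_tempered_def by meson
  obtain M D where D: "D \<ge> 0" "\<And>t x. t \<in> {1/2..2} \<Longrightarrow> x \<in> {0<..1} \<Longrightarrow> \<bar>g t x\<bar> * x ^ M \<le> D"
    using assms(2) unfolding unif_tempered_def by meson
  have "\<bar>f t x * g t x\<bar> * x ^ (N + M) \<le> C * D" if "t \<in> {1/2..2}" "x \<in> {0<..1}" for t x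
  proof -
    have "\<bar>f t x * g t x\<bar> * x ^ (N + M) = (\<bar>f t x\<bar> * x ^ N) * (\<bar>g t x\<bar> * x ^ M)"
      by (simp add: abs_mult power_add mult_ac)
    also have "\<dots> \<le> C * D"
      using C(1) C(2)[OF that] D(2)[OF that] that by (intro mult_mono) auto
    finally show ?thesis .
  qed
  then show ?thesis
    unfolding unif_tempered_def using C(1) D(1) by (intro exI[of _ "N + M"] exI[of _ "C * D"]) auto
qed

lemma unif_tempered_power:
  assumes "unif_tempered f"
  shows   "unif_tempered (\<lambda>t x. f t x ^ m)"
proof (induction m)
  case 0
  show ?case unfolding unif_tempered_def by (intro exI[of _ "0::nat"] exI[of _ "1::real"]) auto
next
  case (Suc m)
  then show ?case using unif_tempered_mult[OF assms] by simp
qed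

text \<open>The splitting \<open>f f' - g g' = (f - g) f' + (f' - g') g\<close> leaves a rapid
  factor in each summand.\<close>

lemma unif_rapid_mult_diff:
  assumes "unif_rapid (\<lambda>t x. f t x - g t x)" "unif_rapid (\<lambda>t x. f' t x - g' t x)"
    and "unif_tempered f'" "unif_tempered g"
  shows   "unif_rapid (\<lambda>t x. f t x * f' t x - g t x * g' t x)"
proof -
  have "unif_rapid (\<lambda>t x. (f t x - g t x) * f' t x + (f' t x - g' t x) * g t x)"
    by (intro unif_rapid_add unif_rapid_mult_tempered assms)
  then show ?thesis by (simp add: algebra_simps)
qed

lemma unif_rapid_power_diff:
  assumes "unif_rapid (\<lambda>t x. f t x - g t x)" "unif_tempered f" "unif_tempered g"
  shows   "unif_rapid (\<lambda>t x. f t x ^ m - g t x ^ m)"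
proof (induction m)
  case 0
  show ?case unfolding unif_rapid_def by auto
next
  case (Suc m)
  then show ?case
    unfolding power_Suc by (intro unif_rapid_mult_diff unif_tempered_power assms)
qed

text \<open>Source of the ranges used for \<open>theta\<close>: if \<open>x \<le> 1\<close> then
  \<open>x / t^2 \<le> 4\<close>, and if \<open>x \<ge> 1\<close> then
  \<open>x / t^2 \<ge> 1/4\<close>.\<close>

lemma divide_square_bounds:
  fixes t x :: real
  assumes "t \<in> {1/2..2}" "x > 0"
  shows   "x / 4 \<le> x / t\<^sup>2" "x / t\<^sup>2 \<le> 4 * x"
proof -
  have t: "t > 0" using assms by simp
  have "t\<^sup>2 \<le> 4" "1/4 \<le> t\<^sup>2"
    using power_mono[of t 2 2] power_mono[of "1/2" t 2] assms t by (simp_all add: power2_eq_square)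
  then show "x / 4 \<le> x / t\<^sup>2" "x / t\<^sup>2 \<le> 4 * x"
    using t assms(2) by (auto simp: field_simps power2_eq_square)
qed

lemma unif_rapid_compose:
  assumes "\<And>N. \<exists>C>0. \<forall>x. 0 < x \<longrightarrow> x \<le> 4 \<longrightarrow> \<bar>f x\<bar> \<le> C * x ^ N"
  shows   "unif_rapid (\<lambda>t x. f x)" "unif_rapid (\<lambda>t x. f (x / t\<^sup>2))"
proof -
  show "unif_rapid (\<lambda>t x. f x)"
    unfolding unif_rapid_def
  proof
    fix N
    obtain C where "C > 0" "\<forall>x. 0 < x \<longrightarrow> x \<le> 4 \<longrightarrow> \<bar>f x\<bar> \<le> C * x ^ N"
      using assms by blast
    then show "\<exists>C\<ge>0. \<forall>t\<in>{1/2..2}. \<forall>x\<in>{0<..1}. \<bar>f x\<bar> \<le> C * x ^ N"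
      by (intro exI[of _ C]) auto
  qed
  show "unif_rapid (\<lambda>t x. f (x / t\<^sup>2))"
    unfolding unif_rapid_def
  proof
    fix N
    obtain C where C: "C > 0" "\<And>x. 0 < x \<Longrightarrow> x \<le> 4 \<Longrightarrow> \<bar>f x\<bar> \<le> C * x ^ N"
      using assms by meson
    have "\<bar>f (x / t\<^sup>2)\<bar> \<le> C * 4 ^ N * x ^ N" if "t \<in> {1/2..2}" "x \<in> {0<..1}" for t x :: real
    proof -
      have x: "0 < x" "x \<le> 1" using that by auto
      have *: "x / t\<^sup>2 \<le> 4 * x" "0 < x / t\<^sup>2" "x / t\<^sup>2 \<le> 4"
        using divide_square_bounds[OF that(1) x(1)] x by linarith+
      then have "\<bar>f (x / t\<^sup>2)\<bar> \<le> C * (x / t\<^sup>2) ^ N"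
        by (intro C(2))
      also have "\<dots> \<le> C * (4 * x) ^ N"
        using C(1) * that by (intro mult_left_mono power_mono) auto
      finally show ?thesis by (simp add: power_mult_distrib)
    qed
    then show "\<exists>C\<ge>0. \<forall>t\<in>{1/2..2}. \<forall>x\<in>{0<..1}. \<bar>f (x / t\<^sup>2)\<bar> \<le> C * x ^ N"
      using C(1) by (intro exI[of _ "C * 4 ^ N"]) auto
  qed
qed

lemma unif_tempered_compose:
  assumes "\<And>x. 0 < x \<Longrightarrow> x \<le> 4 \<Longrightarrow> \<bar>f x\<bar> * x ^ N \<le> C" "C \<ge> 0"
  shows   "unif_tempered (\<lambda>t x. f x)" "unif_tempered (\<lambda>t x. f (x / t\<^sup>2))"
proof -
  show "unif_tempered (\<lambda>t x. f x)"
    unfolding unif_tempered_def using assms by (intro exI[of _ N] exI[of _ C]) auto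
  have "\<bar>f (x / t\<^sup>2)\<bar> * x ^ N \<le> C * 4 ^ N" if "t \<in> {1/2..2}" "x \<in> {0<..1}" for t x :: real
  proof -
    have x: "0 < x" "x \<le> 1" using that by auto
    have *: "x / t\<^sup>2 \<le> 4 * x" "0 < x / t\<^sup>2" "x \<le> 4 * (x / t\<^sup>2)" "x / t\<^sup>2 \<le> 4"
      using divide_square_bounds[OF that(1) x(1)] x by linarith+
    have "\<bar>f (x / t\<^sup>2)\<bar> * x ^ N \<le> \<bar>f (x / t\<^sup>2)\<bar> * (4 * (x / t\<^sup>2)) ^ N"
      using * that by (intro mult_left_mono power_mono) auto
    also have "\<dots> = (\<bar>f (x / t\<^sup>2)\<bar> * (x / t\<^sup>2) ^ N) * 4 ^ N"
      by (simp only: power_mult_distrib mult_ac)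
    also have "\<dots> \<le> C * 4 ^ N"
      using * that by (intro mult_right_mono assms(1)) auto
    finally show ?thesis .
  qed
  then show "unif_tempered (\<lambda>t x. f (x / t\<^sup>2))"
    unfolding unif_tempered_def using assms(2) by (intro exI[of _ N] exI[of _ "C * 4 ^ N"]) auto
qed

lemma theta_tempered:
  assumes "0 < x" "x \<le> 4"
  shows   "\<bar>theta x\<bar> * x ^ 1 \<le> 5" "\<bar>theta_main x\<bar> * x ^ 1 \<le> \<bar>theta_const\<bar> + 2"
    and   "\<bar>theta_deriv x\<bar> * x ^ 2 \<le> 5" "\<bar>theta_main_deriv x\<bar> * x ^ 2 \<le> \<bar>theta_const\<bar>"
proof -
  have s: "0 < sqrt x" "sqrt x \<le> 2" "x = sqrt x * sqrt x"
    using assms real_sqrt_le_mono[of x 4] by auto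
  have "theta x \<le> exp (- 9 * x) * (1 + 1 / (9 * x))"
    using assms by (intro theta_le)
  also have "\<dots> \<le> 1 * (1 + 1 / (9 * x))"
    using assms by (intro mult_right_mono) auto
  finally have "theta x * x \<le> (1 + 1 / (9 * x)) * x"
    using assms by (intro mult_right_mono) auto
  also have "\<dots> = x + 1 / 9"
    using assms by (simp add: field_simps)
  finally show "\<bar>theta x\<bar> * x ^ 1 \<le> 5"
    using assms theta_pos[of x] by simp
  have "\<bar>theta_deriv x\<bar> \<le> exp (- 4 * x) / x * (1 + 1 / (4 * x))"
    using assms by (intro abs_theta_deriv_le)
  also have "\<dots> \<le> 1 / x * (1 + 1 / (4 * x))"
    using assms by (intro mult_right_mono divide_right_mono) auto
  finally have "\<bar>theta_deriv x\<bar> * x ^ 2 \<le> 1 / x * (1 + 1 / (4 * x)) * x ^ 2"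
    by (intro mult_right_mono) auto
  also have "\<dots> = x + 1 / 4"
    using assms by (simp add: field_simps power2_eq_square)
  finally show "\<bar>theta_deriv x\<bar> * x ^ 2 \<le> 5"
    using assms by simp
  have "\<bar>theta_main x\<bar> \<le> \<bar>theta_const / (2 * sqrt x)\<bar> + 1 / 2"
    unfolding theta_main_def by (rule order_trans[OF abs_triangle_ineq4]) simp
  then have "\<bar>theta_main x\<bar> * x ^ 1 \<le> (\<bar>theta_const / (2 * sqrt x)\<bar> + 1 / 2) * x ^ 1"
    using assms by (intro mult_right_mono) auto
  also have "\<dots> = \<bar>theta_const\<bar> * (sqrt x / 2) + x / 2"
  proof -
    have "\<bar>theta_const / (2 * sqrt x)\<bar> * x = \<bar>theta_const\<bar> * (sqrt x / 2)"
      using s by (simp add: abs_mult field_simps)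
    then show ?thesis by (simp add: distrib_right)
  qed
  also have "\<dots> \<le> \<bar>theta_const\<bar> * 1 + 2"
    using s assms by (intro add_mono mult_left_mono) auto
  finally show "\<bar>theta_main x\<bar> * x ^ 1 \<le> \<bar>theta_const\<bar> + 2" by simp
  have "\<bar>theta_main_deriv x\<bar> * x ^ 2 = \<bar>theta_const\<bar> * (sqrt x / 4)"
    unfolding theta_main_deriv_def using s assms by (simp add: abs_mult field_simps power2_eq_square)
  also have "\<dots> \<le> \<bar>theta_const\<bar> * 1"
    using s by (intro mult_left_mono) auto
  finally show "\<bar>theta_main_deriv x\<bar> * x ^ 2 \<le> \<bar>theta_const\<bar>" by simp
qed

section \<open>Heat trace of a box with \<open>m\<close> unit sides and one side \<open>t\<close>,
  and its singular part\<close>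

definition box_theta :: "nat \<Rightarrow> real \<Rightarrow> real \<Rightarrow> real" where
  "box_theta m t x = theta x ^ m * theta (x / t\<^sup>2)"

definition box_main :: "nat \<Rightarrow> real \<Rightarrow> real \<Rightarrow> real" where
  "box_main m t x = theta_main x ^ m * theta_main (x / t\<^sup>2)"

text \<open>The singular part is subtracted only up to \<open>1\<close>, since it does not decay at
  infinity: \<open>theta_main\<close> tends to \<open>- 1 / 2\<close> there. The heat trace itself
  decays exponentially.\<close>

definition box_rest :: "nat \<Rightarrow> real \<Rightarrow> real \<Rightarrow> real" where
  "box_rest m t x = box_theta m t x - (if x \<le> 1 then box_main m t x else 0)"

text \<open>The derivative in the side length \<open>t\<close>, not in the time \<open>x\<close>;
  \<open>- 2 * x / t ^ 3\<close> is the inner derivative of \<open>x / t^2\<close>.\<close>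

definition box_theta_deriv :: "nat \<Rightarrow> real \<Rightarrow> real \<Rightarrow> real" where
  "box_theta_deriv m t x = theta x ^ m * (theta_deriv (x / t\<^sup>2) * (- 2 * x / t ^ 3))"

definition box_main_deriv :: "nat \<Rightarrow> real \<Rightarrow> real \<Rightarrow> real" where
  "box_main_deriv m t x = theta_main x ^ m * (theta_main_deriv (x / t\<^sup>2) * (- 2 * x / t ^ 3))"

definition box_rest_deriv :: "nat \<Rightarrow> real \<Rightarrow> real \<Rightarrow> real" where
  "box_rest_deriv m t x = box_theta_deriv m t x - (if x \<le> 1 then box_main_deriv m t x else 0)"

text \<open>The cutoff depends on \<open>x\<close> alone, so differentiation in \<open>t\<close>
  stays within one branch.\<close>

lemma DERIV_box_rest:
  assumes "t > 0" "x > 0"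
  shows   "((\<lambda>t. box_rest m t x) has_real_derivative box_rest_deriv m t x) (at t)"
proof -
  have inner: "((\<lambda>t. x / t\<^sup>2) has_real_derivative - 2 * x / t ^ 3) (at t)"
    using assms by (auto intro!: derivative_eq_intros simp: field_simps power2_eq_square power3_eq_cube)
  have "((\<lambda>t. box_theta m t x) has_real_derivative box_theta_deriv m t x) (at t)"
    unfolding box_theta_def box_theta_deriv_def
    using assms by (intro DERIV_cmult DERIV_chain2[OF DERIV_theta inner]) auto
  moreover have "((\<lambda>t. box_main m t x) has_real_derivative box_main_deriv m t x) (at t)"
    unfolding box_main_def box_main_deriv_def
    using assms by (intro DERIV_cmult DERIV_chain2[OF DERIV_theta_main inner]) auto
  ultimately show ?thesis
    unfolding box_rest_def box_rest_deriv_def by (auto intro: DERIV_diff)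
qed

lemma unif_rapid_box_diff: "unif_rapid (\<lambda>t x. box_theta m t x - box_main m t x)"
  and unif_rapid_box_deriv_diff: "unif_rapid (\<lambda>t x. box_theta_deriv m t x - box_main_deriv m t x)"
proof -
  have "\<exists>C>0. \<forall>x. 0 < x \<longrightarrow> x \<le> 4 \<longrightarrow> \<bar>theta x - theta_main x\<bar> \<le> C * x ^ N" for N
    using theta_diff_main_rapid[of N] by metis
  note theta = unif_rapid_compose[where f = "\<lambda>x. theta x - theta_main x", OF this]
  have "\<exists>C>0. \<forall>x. 0 < x \<longrightarrow> x \<le> 4 \<longrightarrow> \<bar>theta_deriv x - theta_main_deriv x\<bar> \<le> C * x ^ N" for N
    using theta_diff_main_rapid[of N] by metis
  note deriv = unif_rapid_compose[where f = "\<lambda>x. theta_deriv x - theta_main_deriv x", OF this]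
  note temp = unif_tempered_compose[where f = theta, OF theta_tempered(1)]
    unif_tempered_compose[where f = theta_main, OF theta_tempered(2)]
    unif_tempered_compose[where f = theta_deriv, OF theta_tempered(3)]
    unif_tempered_compose[where f = theta_main_deriv, OF theta_tempered(4)]
  have factor: "unif_tempered (\<lambda>t x. - 2 * x / t ^ 3)"
    unfolding unif_tempered_def
  proof (rule exI[of _ "0::nat"], rule exI[of _ "16::real"], intro conjI ballI)
    fix t x :: real assume "t \<in> {1/2..2}" "x \<in> {0<..1}"
    then have "(1/2) ^ 3 \<le> t ^ 3" "t > 0" "x > 0" "x \<le> 1"
      by (auto intro!: power_mono simp del: power_one_over)
    moreover from this have "2 * x \<le> 16 * t ^ 3"
      by (simp add: power3_eq_cube)
    ultimately show "\<bar>- 2 * x / t ^ 3\<bar> * x ^ 0 \<le> 16"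
      by (simp add: field_simps)
  qed simp
  have pow: "unif_rapid (\<lambda>t x. theta x ^ m - theta_main x ^ m)"
    by (rule unif_rapid_power_diff) (use theta temp in auto)
  show "unif_rapid (\<lambda>t x. box_theta m t x - box_main m t x)"
    unfolding box_theta_def box_main_def
    by (intro unif_rapid_mult_diff unif_tempered_power pow theta temp) auto
  have "unif_rapid (\<lambda>t x. (theta_deriv (x / t\<^sup>2) - theta_main_deriv (x / t\<^sup>2)) * (- 2 * x / t ^ 3))"
    by (intro unif_rapid_mult_tempered deriv factor)
  then have diff: "unif_rapid (\<lambda>t x. theta_deriv (x / t\<^sup>2) * (- 2 * x / t ^ 3) - theta_main_deriv (x / t\<^sup>2) * (- 2 * x / t ^ 3))"
    by (simp only: left_diff_distrib)
  show "unif_rapid (\<lambda>t x. box_theta_deriv m t x - box_main_deriv m t x)"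
    unfolding box_theta_deriv_def box_main_deriv_def
    by (rule unif_rapid_mult_diff[OF pow diff]; intro unif_tempered_mult unif_tempered_power temp factor) auto
qed

lemma cutoff_diff_bound:
  assumes "unif_rapid (\<lambda>t x. f t x - g t x)" "k \<le> N" "B \<ge> 0"
    and large: "\<And>t x. t \<in> {1/2..2} \<Longrightarrow> x \<ge> 1 \<Longrightarrow> \<bar>f t x\<bar> \<le> B * x ^ k * exp (- x)"
  obtains C where "C > 0" "\<And>t x. t \<in> {1/2..2} \<Longrightarrow> x > 0 \<Longrightarrow>
    \<bar>f t x - (if x \<le> 1 then g t x else 0)\<bar> \<le> C * x ^ N * exp (- x)"
proof -
  obtain D where D: "D \<ge> 0" "\<And>t x. t \<in> {1/2..2} \<Longrightarrow> x \<in> {0<..1} \<Longrightarrow> \<bar>f t x - g t x\<bar> \<le> D * x ^ N"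
    using assms(1) unfolding unif_rapid_def by meson
  \<comment> \<open>On \<open>(0, 1]\<close> the factor \<open>exp 1\<close> compensates for
    \<open>exp (- x) \<ge> exp (- 1)\<close>; beyond \<open>1\<close> the bound \<open>B\<close>
    suffices because \<open>x ^ k \<le> x ^ N\<close>. The summand \<open>1\<close> secures
    positivity.\<close>
  define C where "C = D * exp 1 + B + 1"
  have "\<bar>f t x - (if x \<le> 1 then g t x else 0)\<bar> \<le> C * x ^ N * exp (- x)"
    if t: "t \<in> {1/2..2}" and x: "x > 0" for t x
  proof (cases "x \<le> 1")
    case True
    have "\<bar>f t x - g t x\<bar> \<le> D * x ^ N"
      using D(2) t x True by simp
    also have "\<dots> \<le> D * x ^ N * (exp 1 * exp (- x))"
      using D(1) x True by (intro mult_right_le_one_le[THEN order_trans, of _ 1] mult_left_mono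
        [of 1 _ "D * x ^ N", simplified]) (auto simp: exp_add[symmetric])
    also have "\<dots> = (D * exp 1) * x ^ N * exp (- x)"
      by simp
    also have "\<dots> \<le> C * x ^ N * exp (- x)"
      using assms(3) x by (intro mult_right_mono) (auto simp: C_def)
    finally show ?thesis using True by simp
  next
    case False
    have "\<bar>f t x\<bar> \<le> B * x ^ k * exp (- x)"
      using False t by (intro large) auto
    also have "\<dots> \<le> C * x ^ N * exp (- x)"
      using assms(2,3) D(1) False x
      by (intro mult_right_mono mult_mono power_increasing) (auto simp: C_def)
    finally show ?thesis using False by simp
  qed
  moreover have "C > 0" using D(1) assms(3) by (simp add: C_def add_nonneg_pos)
  ultimately show ?thesis using that by blast
qed

lemma theta_dilated_bounds:
  assumes "t \<in> {1/2..2}" "x \<ge> 1"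
  shows   "theta (x / t\<^sup>2) \<le> 2 * exp (- x)" "\<bar>theta_deriv (x / t\<^sup>2)\<bar> \<le> 8 * exp (- x)"
    and   "0 < theta x" "theta x \<le> 2" "0 < theta (x / t\<^sup>2)"
proof -
  have x: "x > 0" using assms by simp
  have *: "x \<le> 4 * (x / t\<^sup>2)" "x / t\<^sup>2 \<ge> 1/4" "0 < x / t\<^sup>2"
    using divide_square_bounds[OF assms(1) x] assms(2) by linarith+
  have "theta (x / t\<^sup>2) \<le> 2 * exp (- 4 * (x / t\<^sup>2))"
    using * by (intro theta_le_exp)
  also have "\<dots> \<le> 2 * exp (- x)"
    using * by (intro mult_left_mono) auto
  finally show "theta (x / t\<^sup>2) \<le> 2 * exp (- x)" .
  have "\<bar>theta_deriv (x / t\<^sup>2)\<bar> \<le> 8 * exp (- 4 * (x / t\<^sup>2))"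
    using * by (intro abs_theta_deriv_le_exp)
  also have "\<dots> \<le> 8 * exp (- x)"
    using * by (intro mult_left_mono) auto
  finally show "\<bar>theta_deriv (x / t\<^sup>2)\<bar> \<le> 8 * exp (- x)" .
  show "0 < theta x" "0 < theta (x / t\<^sup>2)"
    using assms * by (auto intro!: theta_pos)
  have "theta x \<le> 2 * exp (- 4 * x)"
    using assms by (intro theta_le_exp) auto
  also have "\<dots> \<le> 2"
    using assms by simp
  finally show "theta x \<le> 2" .
qed

lemma box_rest_bound:
  obtains C where "C > 0" "\<And>t x. t \<in> {1/2..2} \<Longrightarrow> x > 0 \<Longrightarrow> \<bar>box_rest m t x\<bar> \<le> C * x ^ N * exp (- x)"
proof -
  have large: "\<bar>box_theta m t x\<bar> \<le> 2 ^ m * 2 * x ^ 0 * exp (- x)" if "t \<in> {1/2..2}" "x \<ge> 1" for t x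
  proof -
    note * = theta_dilated_bounds[OF that]
    have "\<bar>box_theta m t x\<bar> = theta x ^ m * theta (x / t\<^sup>2)"
      using * by (simp add: box_theta_def)
    also have "\<dots> \<le> 2 ^ m * (2 * exp (- x))"
      using * by (intro mult_mono power_mono) auto
    finally show ?thesis by simp
  qed
  from cutoff_diff_bound[OF unif_rapid_box_diff _ _ large, where N = N] show ?thesis
    using that unfolding box_rest_def by auto
qed

text \<open>One power of \<open>x\<close> is what the division by \<open>x\<close> in the Mellin
  integrand at \<open>s = 0\<close> consumes.\<close>

lemma box_rest_deriv_bound:
  obtains C where "C > 0"
    "\<And>t x. t \<in> {1/2..2} \<Longrightarrow> x > 0 \<Longrightarrow> \<bar>box_rest_deriv m t x\<bar> \<le> C * x * exp (- x)"
proof -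
  \<comment> \<open>The constant is \<open>8 * 16\<close>: \<open>8\<close> from the bound on
    \<open>theta_deriv\<close>, and \<open>16\<close> from \<open>2 / t ^ 3\<close> at
    \<open>t = 1/2\<close>.\<close>
  have large: "\<bar>box_theta_deriv m t x\<bar> \<le> 2 ^ m * 128 * x ^ 1 * exp (- x)" if "t \<in> {1/2..2}" "x \<ge> 1" for t x
  proof -
    note * = theta_dilated_bounds[OF that]
    have "(1/2) ^ 3 \<le> t ^ 3" "t > 0"
      using that by (auto intro!: power_mono simp del: power_one_over)
    then have "\<bar>- 2 * x / t ^ 3\<bar> \<le> 16 * x"
      using that by (simp add: field_simps power3_eq_cube)
    then have a: "\<bar>theta_deriv (x / t\<^sup>2)\<bar> * \<bar>- 2 * x / t ^ 3\<bar> \<le> (8 * exp (- x)) * (16 * x)"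
      using * by (intro mult_mono) auto
    have b: "theta x ^ m \<le> 2 ^ m"
      using * by (intro power_mono) auto
    have "theta x ^ m * (\<bar>theta_deriv (x / t\<^sup>2)\<bar> * \<bar>- 2 * x / t ^ 3\<bar>) \<le> 2 ^ m * ((8 * exp (- x)) * (16 * x))"
      by (rule mult_mono[OF b a]) auto
    moreover have "\<bar>box_theta_deriv m t x\<bar> = theta x ^ m * (\<bar>theta_deriv (x / t\<^sup>2)\<bar> * \<bar>- 2 * x / t ^ 3\<bar>)"
      unfolding box_theta_deriv_def abs_mult power_abs using * by simp
    ultimately show ?thesis by (simp add: mult_ac)
  qed
  from cutoff_diff_bound[OF unif_rapid_box_deriv_diff _ _ large, where N = 1] show ?thesis
    using that unfolding box_rest_deriv_def by auto
qed

lemma continuous_on_theta: "continuous_on {0<..} theta"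
  by (rule DERIV_continuous_on[OF has_field_derivative_at_within[OF DERIV_theta]]) auto

lemma continuous_on_theta_main: "continuous_on {0<..} theta_main"
  by (rule DERIV_continuous_on[OF has_field_derivative_at_within[OF DERIV_theta_main]]) auto

lemma continuous_on_box:
  assumes "t > 0"
  shows "continuous_on {0<..} (box_theta m t)" "continuous_on {0<..} (box_main m t)"
proof -
  have "continuous_on {0<..} (\<lambda>x. theta (x / t\<^sup>2))" "continuous_on {0<..} (\<lambda>x. theta_main (x / t\<^sup>2))"
    using assms by (auto intro!: continuous_on_compose2[OF continuous_on_theta]
      continuous_on_compose2[OF continuous_on_theta_main] continuous_intros)
  then show "continuous_on {0<..} (box_theta m t)" "continuous_on {0<..} (box_main m t)"
    unfolding box_theta_def[abs_def] box_main_def[abs_def]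
    by (intro continuous_intros continuous_on_theta continuous_on_theta_main; simp)+
qed

lemma borel_measurable_box [measurable]:
  assumes "t > 0"
  shows "(\<lambda>x. indicator {0<..} x * box_theta m t x) \<in> borel_measurable borel"
    and "(\<lambda>x. indicator {0<..} x * box_main m t x) \<in> borel_measurable borel"
    and "(\<lambda>x. indicator {0<..} x * (if x \<le> 1 then box_main m t x else 0)) \<in> borel_measurable borel"
    and "(\<lambda>x. indicator {0<..} x * box_rest m t x) \<in> borel_measurable borel"
proof -
  show [measurable]: "(\<lambda>x. indicator {0<..} x * box_theta m t x) \<in> borel_measurable borel"
    using borel_measurable_continuous_on_indicator[OF _ continuous_on_box(1)[OF assms], of m] by simp
  show [measurable]: "(\<lambda>x. indicator {0<..} x * box_main m t x) \<in> borel_measurable borel"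
    using borel_measurable_continuous_on_indicator[OF _ continuous_on_box(2)[OF assms], of m] by simp
  have "(\<lambda>x. if x \<le> 1 then indicator {0<..} x * box_main m t x else 0) \<in> borel_measurable borel"
    by measurable
  also have "(\<lambda>x. if x \<le> 1 then indicator {0<..} x * box_main m t x else 0) =
      (\<lambda>x. indicator {0<..} x * (if x \<le> 1 then box_main m t x else 0))"
    by auto
  finally show [measurable]: "(\<lambda>x. indicator {0<..} x * (if x \<le> 1 then box_main m t x else 0)) \<in> borel_measurable borel" .
  show "(\<lambda>x. indicator {0<..} x * box_rest m t x) \<in> borel_measurable borel"
    unfolding box_rest_def right_diff_distrib by measurable
qed

lemma rapid_box_rest: "t \<in> {1/2..2} \<Longrightarrow> rapid (box_rest m t)"
  unfolding rapid_def
proof (intro conjI allI)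
  assume t: "t \<in> {1/2..2}"
  then show "(\<lambda>x. indicator {0<..} x * box_rest m t x) \<in> borel_measurable borel"
    by (intro borel_measurable_box) auto
  show "\<exists>C>0. \<forall>x>0. \<bar>box_rest m t x\<bar> \<le> C * x ^ N * exp (- x)" for N
    using box_rest_bound[of m N] t by metis
qed

section \<open>The Mellin transform at zero as a function of the side length\<close>

definition rest_at_0 :: "nat \<Rightarrow> real \<Rightarrow> real" where
  "rest_at_0 m t = (\<integral>x. indicator {0<..} x * (box_rest m t x / x) \<partial>lborel)"

lemma mellin_box_rest_0: "mellin (box_rest m t) 0 = of_real (rest_at_0 m t)"
proof -
  have *: "indicator {0<..} x *\<^sub>R (of_real x powr (0 - 1) * of_real (box_rest m t x)) =
        complex_of_real (indicator {0<..} x * (box_rest m t x / x))" for x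
    by (auto simp: indicator_def powr_minus divide_inverse)
  show ?thesis
    unfolding mellin_def rest_at_0_def * integral_complex_of_real ..
qed

lemma differentiable_rest_at_0: "\<exists>D. (rest_at_0 m has_real_derivative D) (at 1)"
proof -
  obtain C where C: "C > 0" "\<And>t x. t \<in> {1/2..2} \<Longrightarrow> x > 0 \<Longrightarrow> \<bar>box_rest_deriv m t x\<bar> \<le> C * x * exp (- x)"
    using box_rest_deriv_bound by blast
  obtain B where B: "B > 0" "\<And>t x. t \<in> {1/2..2} \<Longrightarrow> x > 0 \<Longrightarrow> \<bar>box_rest m t x\<bar> \<le> B * x ^ 1 * exp (- x)"
    using box_rest_bound by blast
  define f where "f = (\<lambda>t x. indicator {0<..} x * (box_rest m t x / x))"
  define f' where "f' = (\<lambda>t x. indicator {0<..} x * (box_rest_deriv m t x / x))"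
  have f_meas [measurable]: "f t \<in> borel_measurable borel" if "t > 0" for t
  proof -
    have [measurable]: "(\<lambda>x. indicator {0<..} x * box_rest m t x) \<in> borel_measurable borel"
      using that by (intro borel_measurable_box)
    have "(\<lambda>x. indicator {0<..} x * box_rest m t x / x) \<in> borel_measurable borel"
      by measurable
    then show ?thesis by (simp add: f_def)
  qed
  have deriv: "((\<lambda>t. f t x) has_real_derivative f' t x) (at t)" if "t > 0" for t x
    unfolding f_def f'_def
    by (cases "x > 0") (auto intro!: DERIV_cmult DERIV_cdivide DERIV_box_rest that)
  \<comment> \<open>Measurability is inherited from \<open>f\<close> through a pointwise limit of
    difference quotients, so that no continuity of \<open>theta_deriv\<close> enters.\<close>
  have f'_meas: "f' 1 \<in> borel_measurable borel"
  proof (rule borel_measurable_LIMSEQ_metric)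
    show "(\<lambda>x. (f (1 + inverse (real (Suc n))) x - f 1 x) / inverse (real (Suc n))) \<in> borel_measurable borel" for n
      by (intro borel_measurable_divide borel_measurable_diff f_meas) (auto intro: add_pos_pos)
    show "(\<lambda>n. (f (1 + inverse (real (Suc n))) x - f 1 x) / inverse (real (Suc n))) \<longlonglongrightarrow> f' 1 x" for x
    proof -
      have "((\<lambda>h. (f (1 + h) x - f 1 x) / h) \<longlongrightarrow> f' 1 x) (at 0)"
        using deriv[of 1 x] by (simp add: DERIV_def)
      moreover have "filterlim (\<lambda>n. inverse (real (Suc n))) (at 0) sequentially"
        using LIMSEQ_inverse_real_of_nat by (auto simp: filterlim_at)
      ultimately show ?thesis
        by (rule filterlim_compose)
    qed
  qed
  have "((\<lambda>t. \<integral>x. f t x \<partial>lborel) has_field_derivative (\<integral>x. f' 1 x \<partial>lborel)) (at 1)"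
  proof (rule has_field_derivative_integral_parameter[where U = "{1/2<..<2}" and
           g = "\<lambda>x. C * (indicator {0<..} x * exp (- 1 * x))"])
    fix t x :: real assume t: "t \<in> {1/2<..<2}"
    show "((\<lambda>t. f t x) has_field_derivative f' t x) (at t)"
      using t by (intro deriv) auto
    show "norm (f' t x) \<le> C * (indicator {0<..} x * exp (- 1 * x))"
      using C(2)[of t x] t by (auto simp: f'_def indicator_def field_simps)
  next
    fix t :: real assume t: "t \<in> {1/2<..<2}"
    show "integrable lborel (f t)"
    proof (rule Bochner_Integration.integrable_bound)
      show "integrable lborel (\<lambda>x. B * (indicator {0<..} x * exp (- 1 * x)))"
        by (intro integrable_mult_right integrable_indicator_exp) auto
      show "f t \<in> borel_measurable lborel"
        using f_meas[of t] t by simp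
      show "AE x in lborel. norm (f t x) \<le> norm (B * (indicator {0<..} x * exp (- 1 * x)))"
        using B t by (intro AE_I2) (auto simp: f_def indicator_def field_simps)
    qed
  next
    show "integrable lborel (\<lambda>x. C * (indicator {0<..} x * exp (- 1 * x)))"
      by (intro integrable_mult_right integrable_indicator_exp) auto
  qed (use f'_meas in auto)
  then show ?thesis
    by (auto simp: f_def rest_at_0_def[abs_def])
qed

section \<open>The zeta series as a Mellin transform\<close>

text \<open>Transfers gauge integrals to Lebesgue integrals; Borel measurability allows the passage
  from \<open>lebesgue\<close> to \<open>lborel\<close>.\<close>

lemma has_bochner_integral_lborelI:
  fixes f :: "real \<Rightarrow> complex"
  assumes "f absolutely_integrable_on A" "(f has_integral I) A"
    and "(\<lambda>x. indicator A x *\<^sub>R f x) \<in> borel_measurable borel"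
  shows "has_bochner_integral lborel (\<lambda>x. indicator A x *\<^sub>R f x) I"
proof -
  have "integrable lebesgue (\<lambda>x. indicator A x *\<^sub>R f x)"
    using assms(1) by (simp add: set_integrable_def)
  then have *: "integrable lborel (\<lambda>x. indicator A x *\<^sub>R f x)"
    using assms(3) by (subst (asm) integrable_completion) auto
  then have "set_integrable lborel A f"
    by (simp add: set_integrable_def)
  from set_borel_integral_eq_integral(2)[OF this] show ?thesis
    using * integral_unique[OF assms(2)] by (simp add: has_bochner_integral_iff set_lebesgue_integral_def)
qed

lemma has_bochner_integral_powr_from_0:
  assumes w: "Re w > 0"
  shows "has_bochner_integral lborel (\<lambda>x. indicator {0<..1} x *\<^sub>R (complex_of_real x powr (w - 1))) (1 / w)"
proof (rule has_bochner_integral_lborelI)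
  have w0: "w \<noteq> 0" using w by auto
  have "((\<lambda>x. complex_of_real x powr (w - 1)) has_integral
          (complex_of_real 1 powr w / w - complex_of_real 0 powr w / w)) {0..1}"
  proof (rule fundamental_theorem_of_calculus_interior)
    \<comment> \<open>As \<open>Re w > 0\<close>, the antiderivative extends continuously to
      \<open>0\<close> with value \<open>0\<close>, while its derivative may blow up there; hence
      the interior form of the fundamental theorem.\<close>
    show "continuous_on {0..1} (\<lambda>x. complex_of_real x powr w / w)"
      using w w0 by (intro continuous_intros) auto
    show "((\<lambda>x. complex_of_real x powr w / w) has_vector_derivative complex_of_real x powr (w - 1)) (at x)"
      if "x \<in> {0<..<1}" for x
    proof -
      have "((\<lambda>z. z powr w / w) has_field_derivative complex_of_real x powr (w - 1)) (at (of_real x))"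
        using that w0 by (auto intro!: derivative_eq_intros)
      then show ?thesis
        by (rule has_vector_derivative_real_field)
    qed
  qed auto
  then have *: "((\<lambda>x. complex_of_real x powr (w - 1)) has_integral 1 / w) {0..1}"
    using w0 by simp
  then show **: "((\<lambda>x. complex_of_real x powr (w - 1)) has_integral 1 / w) {0<..1}"
    by (subst has_integral_spike_set_eq) (auto intro: negligible_subset[of "{0}"])
  have "(\<lambda>x. x powr (Re w - 1)) integrable_on {0..1}"
    using w by (intro integrable_on_powr_from_0) auto
  then have "(\<lambda>x. x powr (Re w - 1)) integrable_on {0<..1}"
    by (rule integrable_spike_set) (auto intro: negligible_subset[of "{0}"])
  then have "(\<lambda>x. norm (complex_of_real x powr (w - 1))) integrable_on {0<..1}"
    by (rule integrable_eq) (auto simp: norm_powr_real_powr)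
  with ** show "(\<lambda>x. complex_of_real x powr (w - 1)) absolutely_integrable_on {0<..1}"
    unfolding absolutely_integrable_on_def by (auto simp: has_integral_iff)
  show "(\<lambda>x. indicator {0<..1} x *\<^sub>R (complex_of_real x powr (w - 1))) \<in> borel_measurable borel"
    by (intro borel_measurable_continuous_on_indicator continuous_intros) auto
qed

text \<open>Euler's integral for \<open>Gamma s\<close> under the substitution \<open>x\<close> to
  \<open>l * x\<close>, multiplied by \<open>l powr (1 - s)\<close> to clear the scaling.\<close>

lemma has_bochner_integral_Gamma_scaled:
  assumes s: "Re s > 0" and l: "l > 0"
  shows "has_bochner_integral lborel
    (\<lambda>x. indicator {0<..} x *\<^sub>R (complex_of_real x powr (s - 1) * of_real (exp (- (l * x)))))
    (Gamma s * of_real l powr (- s))"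
proof -
  have "has_bochner_integral lborel
      (\<lambda>x. indicator {0<..} x *\<^sub>R (complex_of_real x powr (s - 1) / of_real (exp x))) (Gamma s)"
    by (intro has_bochner_integral_lborelI absolutely_integrable_Gamma_integral' Gamma_integral_complex' s
        borel_measurable_continuous_on_indicator continuous_intros) auto
  then have "has_bochner_integral lborel
      (\<lambda>x. indicator {0<..} (0 + l * x) *\<^sub>R (complex_of_real (0 + l * x) powr (s - 1) / of_real (exp (0 + l * x))))
      (Gamma s /\<^sub>R \<bar>l\<bar>)"
    using l by (subst (asm) lborel_has_bochner_integral_real_affine_iff[of l _ _ 0]) auto
  then have "has_bochner_integral lborel
      (\<lambda>x. of_real l powr (1 - s) * (indicator {0<..} (0 + l * x) *\<^sub>R
         (complex_of_real (0 + l * x) powr (s - 1) / of_real (exp (0 + l * x)))))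
      (of_real l powr (1 - s) * (Gamma s /\<^sub>R \<bar>l\<bar>))"
    by (intro has_bochner_integral_mult_right) auto
  also have "of_real l powr (1 - s) * (Gamma s /\<^sub>R \<bar>l\<bar>) = Gamma s * of_real l powr (- s)"
    using l by (simp add: powr_diff powr_minus scaleR_conv_of_real divide_inverse)
  also have "(\<lambda>x. of_real l powr (1 - s) * (indicator {0<..} (0 + l * x) *\<^sub>R
         (complex_of_real (0 + l * x) powr (s - 1) / of_real (exp (0 + l * x))))) =
      (\<lambda>x. indicator {0<..} x *\<^sub>R (complex_of_real x powr (s - 1) * of_real (exp (- (l * x)))))"
  proof
    fix x :: real
    show "of_real l powr (1 - s) * (indicator {0<..} (0 + l * x) *\<^sub>R
         (complex_of_real (0 + l * x) powr (s - 1) / of_real (exp (0 + l * x)))) =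
      indicator {0<..} x *\<^sub>R (complex_of_real x powr (s - 1) * of_real (exp (- (l * x))))"
    proof (cases "x > 0")
      case True
      have "complex_of_real (l * x) powr (s - 1) = of_real l powr (s - 1) * of_real x powr (s - 1)"
        using True l by (simp add: powr_times_real)
      moreover have "of_real l powr (1 - s) * of_real l powr (s - 1) = (1 :: complex)"
        using l by (simp add: powr_add[symmetric])
      ultimately have "of_real l powr (1 - s) * complex_of_real (l * x) powr (s - 1) = of_real x powr (s - 1)"
        by (simp add: mult.assoc[symmetric])
      then show ?thesis
        using True l by (simp add: exp_minus divide_inverse mult.assoc[symmetric])
    qed (use l in \<open>simp add: zero_less_mult_iff\<close>)
  qed
  finally show ?thesis .
qed

text \<open>With \<open>y = theta_const / (2 * sqrt x)\<close> one has
  \<open>theta_main x = y - 1 / 2\<close> and \<open>theta_main (x / t^2) = t * y - 1 / 2\<close>.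
  So \<open>box_main\<close> is a polynomial in \<open>y\<close>, and this is its coefficient at
  \<open>x powr (- i / 2)\<close>.\<close>

definition main_coeff :: "nat \<Rightarrow> real \<Rightarrow> nat \<Rightarrow> real" where
  "main_coeff m t i = coeff ([:- 1 / 2, 1:] ^ m * [:- 1 / 2, t:]) i * (theta_const / 2) ^ i"

lemma poly_eq_sum_le:
  fixes p :: "real poly"
  assumes "degree p \<le> n"
  shows   "poly p x = (\<Sum>i\<le>n. coeff p i * x ^ i)"
  unfolding poly_altdef using assms by (intro sum.mono_neutral_left) (auto simp: coeff_eq_0)

lemma box_main_eq_sum:
  assumes "t > 0" "x > 0"
  shows   "box_main m t x = (\<Sum>i\<le>Suc m. main_coeff m t i * x powr (- (real i / 2)))"
proof -
  define y where "y = theta_const / 2 * x powr (- (1 / 2))"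
  have sqrt: "x powr (- (1 / 2)) = 1 / sqrt x"
    using powr_minus[of x "1 / 2"] powr_half_sqrt[of x] assms by (simp add: inverse_eq_divide)
  have y: "theta_main x = - 1 / 2 + y" "theta_main (x / t\<^sup>2) = - 1 / 2 + t * y"
    using assms by (simp_all add: theta_main_def y_def sqrt real_sqrt_divide field_simps)
  have "degree ([:- 1 / 2, 1 :: real:] ^ m) \<le> 1 * m"
    by (rule order_trans[OF degree_power_le]) simp
  moreover have "degree [:- 1 / 2, t:] \<le> 1"
    by simp
  ultimately have deg: "degree ([:- 1 / 2, 1:] ^ m * [:- 1 / 2, t:]) \<le> Suc m"
    by (intro order_trans[OF degree_mult_le]) linarith
  have "box_main m t x = poly ([:- 1 / 2, 1:] ^ m * [:- 1 / 2, t:]) y"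
    by (simp add: box_main_def y poly_power algebra_simps)
  also have "\<dots> = (\<Sum>i\<le>Suc m. coeff ([:- 1 / 2, 1:] ^ m * [:- 1 / 2, t:]) i * y ^ i)"
    by (rule poly_eq_sum_le[OF deg])
  also have "\<dots> = (\<Sum>i\<le>Suc m. main_coeff m t i * x powr (- (real i / 2)))"
  proof (rule sum.cong[OF refl])
    fix i
    have "y ^ i = (theta_const / 2) ^ i * (x powr (- (1 / 2))) ^ i"
      by (simp only: y_def power_mult_distrib)
    also have "(x powr (- (1 / 2))) ^ i = x powr (- (real i / 2))"
      using assms by (simp add: powr_realpow[symmetric] powr_powr)
    finally show "coeff ([:- 1 / 2, 1:] ^ m * [:- 1 / 2, t:]) i * y ^ i = main_coeff m t i * x powr (- (real i / 2))"
      by (simp add: main_coeff_def)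
  qed
  finally show ?thesis .
qed

text \<open>Each subtracted power integrates over \<open>(0, 1]\<close> to
  \<open>1 / (s - i / 2)\<close>, which converges because
  \<open>i / 2 \<le> (m + 1) / 2 < Re s\<close>.\<close>

lemma has_bochner_integral_box_theta:
  assumes t: "t \<in> {1/2..2}" and s: "Re s > real (Suc m) / 2"
  shows "has_bochner_integral lborel
    (\<lambda>x. indicator {0<..} x *\<^sub>R (complex_of_real x powr (s - 1) * of_real (box_theta m t x)))
    (mellin (box_rest m t) s + (\<Sum>i\<le>Suc m. of_real (main_coeff m t i) / (s - of_nat i / 2)))"
proof -
  have rest: "has_bochner_integral lborel
    (\<lambda>x. indicator {0<..} x *\<^sub>R (complex_of_real x powr (s - 1) * of_real (box_rest m t x))) (mellin (box_rest m t) s)"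
    unfolding mellin_def by (intro has_bochner_integral_integrable integrable_mellin rapid_box_rest t)
  have "has_bochner_integral lborel
      (\<lambda>x. \<Sum>i\<le>Suc m. of_real (main_coeff m t i) *
              (indicator {0<..1} x *\<^sub>R (complex_of_real x powr ((s - of_nat i / 2) - 1))))
      (\<Sum>i\<le>Suc m. of_real (main_coeff m t i) * (1 / (s - of_nat i / 2)))"
  proof (intro has_bochner_integral_sum has_bochner_integral_mult_right has_bochner_integral_powr_from_0)
    fix i assume "i \<in> {..Suc m}"
    then have "real i / 2 \<le> real (Suc m) / 2" by simp
    then show "Re (s - of_nat i / 2) > 0" using s by simp
  qed
  from has_bochner_integral_add[OF rest this]
  have "has_bochner_integral lborel
      (\<lambda>x. indicator {0<..} x *\<^sub>R (complex_of_real x powr (s - 1) * of_real (box_rest m t x)) +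
        (\<Sum>i\<le>Suc m. of_real (main_coeff m t i) *
              (indicator {0<..1} x *\<^sub>R (complex_of_real x powr ((s - of_nat i / 2) - 1)))))
      (mellin (box_rest m t) s + (\<Sum>i\<le>Suc m. of_real (main_coeff m t i) / (s - of_nat i / 2)))"
    by simp
  also have "(\<lambda>x. indicator {0<..} x *\<^sub>R (complex_of_real x powr (s - 1) * of_real (box_rest m t x)) +
        (\<Sum>i\<le>Suc m. of_real (main_coeff m t i) *
              (indicator {0<..1} x *\<^sub>R (complex_of_real x powr ((s - of_nat i / 2) - 1))))) =
      (\<lambda>x. indicator {0<..} x *\<^sub>R (complex_of_real x powr (s - 1) * of_real (box_theta m t x)))"
  proof
    fix x :: real
    consider "x \<le> 0" | "0 < x" "x \<le> 1" | "x > 1" by linarith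
    then show "indicator {0<..} x *\<^sub>R (complex_of_real x powr (s - 1) * of_real (box_rest m t x)) +
        (\<Sum>i\<le>Suc m. of_real (main_coeff m t i) *
              (indicator {0<..1} x *\<^sub>R (complex_of_real x powr ((s - of_nat i / 2) - 1)))) =
      indicator {0<..} x *\<^sub>R (complex_of_real x powr (s - 1) * of_real (box_theta m t x))"
    proof cases
      case 2
      have "of_real (main_coeff m t i) * (complex_of_real x powr ((s - of_nat i / 2) - 1)) =
          complex_of_real x powr (s - 1) * of_real (main_coeff m t i * x powr (- (real i / 2)))" for i
      proof -
        have "complex_of_real x powr ((s - 1) + of_real (- (real i / 2))) =
            complex_of_real x powr (s - 1) * of_real (x powr (- (real i / 2)))"
          using 2 by (simp only: powr_add powr_of_real)
        moreover have "(s - of_nat i / 2) - 1 = (s - 1) + of_real (- (real i / 2))"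
          by simp
        ultimately show ?thesis by (simp only: of_real_mult mult_ac)
      qed
      then have "(\<Sum>i\<le>Suc m. of_real (main_coeff m t i) * (complex_of_real x powr ((s - of_nat i / 2) - 1))) =
          (\<Sum>i\<le>Suc m. complex_of_real x powr (s - 1) * of_real (main_coeff m t i * x powr (- (real i / 2))))"
        by (simp only:)
      also have "\<dots> = complex_of_real x powr (s - 1) * of_real (\<Sum>i\<le>Suc m. main_coeff m t i * x powr (- (real i / 2)))"
        by (simp only: of_real_sum sum_distrib_left)
      also have "(\<Sum>i\<le>Suc m. main_coeff m t i * x powr (- (real i / 2))) = box_main m t x"
        using 2 t by (intro box_main_eq_sum[symmetric]) auto
      finally have "(\<Sum>i\<le>Suc m. of_real (main_coeff m t i) * (complex_of_real x powr ((s - of_nat i / 2) - 1))) =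
          complex_of_real x powr (s - 1) * of_real (box_main m t x)" .
      then show ?thesis
        using 2 by (simp add: box_rest_def distrib_left[symmetric] del: sum.atMost_Suc)
    qed (auto simp: box_rest_def)
  qed
  finally show ?thesis .
qed

section \<open>The heat trace as a sum over eigenvalues\<close>

definition positive_indices :: "('n::finite \<Rightarrow> nat) set" where
  "positive_indices = {k. \<forall>j. k j > 0}"

definition box :: "'n::finite \<Rightarrow> real \<Rightarrow> real ^ 'n" where
  "box j t = (\<chi> i. if i = j then t else 1)"

lemma dirichlet_eigenvalue_pos:
  assumes "t > 0" "k \<in> positive_indices"
  shows   "dirichlet_eigenvalue (box j t) k > 0"
  unfolding dirichlet_eigenvalue_def using assms
  by (auto intro!: mult_pos_pos sum_pos divide_pos_pos simp: box_def positive_indices_def)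

lemma theta_has_sum:
  assumes "x > 0"
  shows   "((\<lambda>k. exp (- (pi\<^sup>2 * x * (real k)\<^sup>2))) has_sum theta x) {0<..}"
proof -
  have norm: "\<bar>theta_term x k\<bar> = theta_term x k" for k
    by (simp add: theta_term_def)
  have "(theta_term x has_sum theta x) UNIV"
    using summable_theta_term[OF assms] unfolding theta_def
    by (intro norm_summable_imp_has_sum summable_sums) (simp_all add: norm)
  moreover have "bij_betw Suc UNIV {0<..}"
    by (simp add: bij_betw_def greaterThan_0)
  ultimately show ?thesis
    unfolding theta_term_def[abs_def]
    using has_sum_reindex_bij_betw[of Suc UNIV "{0<..}" "\<lambda>k. exp (- (pi\<^sup>2 * x * (real k)\<^sup>2))"] by simp
qed

text \<open>The eigenvalue is a sum over coordinates, so its exponential factorises and the lattice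
  sum becomes a product of one-dimensional theta values: \<open>theta (x / t^2)\<close> for side
  \<open>j\<close>, \<open>theta x\<close> for each other side.\<close>

lemma exp_eigenvalue_has_sum:
  assumes t: "t > 0" and x: "x > 0"
  shows "((\<lambda>k. exp (- (dirichlet_eigenvalue (box (j :: 'n::finite) t) k * x))) has_sum box_theta (CARD('n) - 1) t x)
           positive_indices"
proof -
  let ?y = "\<lambda>i. x / (box j t $ i)\<^sup>2"
  let ?f = "\<lambda>i k. exp (- (pi\<^sup>2 * ?y i * (real k)\<^sup>2))"
  have y: "?y i > 0" for i using t x by (simp add: box_def)
  have "(\<Sum>\<^sub>\<infinity>k\<in>PiE UNIV (\<lambda>_::'n. {0<..}). \<Prod>i\<in>UNIV. ?f i (k i)) = (\<Prod>i\<in>UNIV. \<Sum>\<^sub>\<infinity>k\<in>{0<..}. ?f i k)"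
    using theta_has_sum[OF y] by (intro infsum_prod_PiE_abs) (auto simp: summable_on_def)
  also have "\<dots> = (\<Prod>i\<in>UNIV. theta (?y i))"
    by (intro prod.cong refl infsumI theta_has_sum y)
  also have "\<dots> = theta (?y j) * (\<Prod>i\<in>UNIV - {j}. theta (?y i))"
    by (rule prod.remove) auto
  also have "(\<Prod>i\<in>UNIV - {j}. theta (?y i)) = (\<Prod>i\<in>UNIV - {j}. theta x)"
    by (intro prod.cong) (auto simp: box_def)
  also have "theta (?y j) * (\<Prod>i\<in>UNIV - {j}. theta x) = box_theta (CARD('n) - 1) t x"
    by (simp add: box_theta_def box_def card_Diff_singleton)
  finally have *: "(\<Sum>\<^sub>\<infinity>k\<in>PiE UNIV (\<lambda>_::'n. {0<..}). \<Prod>i\<in>UNIV. ?f i (k i)) = box_theta (CARD('n) - 1) t x" .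
  moreover have "box_theta (CARD('n) - 1) t x > 0"
    unfolding box_theta_def using t x by (intro mult_pos_pos zero_less_power theta_pos) auto
  \<comment> \<open>A sum that does not converge has \<open>infsum\<close> equal to
    \<open>0\<close>, so the positive value certifies summability.\<close>
  ultimately have "(\<lambda>k. \<Prod>i\<in>UNIV. ?f i (k i)) summable_on PiE UNIV (\<lambda>_::'n. {0<..})"
    using infsum_not_exists by fastforce
  with * have "((\<lambda>k. \<Prod>i\<in>UNIV. ?f i (k i)) has_sum box_theta (CARD('n) - 1) t x) (PiE UNIV (\<lambda>_::'n. {0<..}))"
    by (simp add: has_sum_iff)
  moreover have "PiE UNIV (\<lambda>_::'n. {0<..}) = positive_indices"
    by (auto simp: positive_indices_def PiE_def)
  moreover have "(\<Prod>i\<in>UNIV. ?f i (k i)) = exp (- (dirichlet_eigenvalue (box j t) k * x))" for k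
    by (simp add: exp_sum[symmetric] dirichlet_eigenvalue_def sum_negf sum_distrib_left sum_distrib_right mult_ac)
  ultimately show ?thesis by simp
qed

text \<open>An enumeration of \<open>K\<close> reduces the interchange to series of integrals. The
  integrals of the norms have partial sums bounded by the integral of \<open>g\<close>.\<close>

lemma infsum_lebesgue_integral:
  fixes f :: "'a \<Rightarrow> 'b \<Rightarrow> 'c::{banach, second_countable_topology}"
  assumes K: "countable K" "infinite K"
    and f: "\<And>k. k \<in> K \<Longrightarrow> integrable M (f k)"
    and norm: "\<And>x. x \<in> space M \<Longrightarrow> ((\<lambda>k. norm (f k x)) has_sum g x) K"
    and g: "integrable M g"
    and F: "\<And>x. x \<in> space M \<Longrightarrow> ((\<lambda>k. f k x) has_sum F x) K"
  shows "(\<Sum>\<^sub>\<infinity>k\<in>K. \<integral>x. f k x \<partial>M) = (\<integral>x. F x \<partial>M)"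
proof -
  define e where "e = from_nat_into K"
  have e: "bij_betw e UNIV K"
    unfolding e_def using K by (intro bij_betw_from_nat_into)
  then have eK: "e i \<in> K" for i by (auto simp: bij_betw_def)
  have norm': "((\<lambda>i. norm (f (e i) x)) has_sum g x) UNIV" if "x \<in> space M" for x
    using norm[OF that] has_sum_reindex_bij_betw[OF e, of "\<lambda>k. norm (f k x)"] by simp
  have sums: "(\<lambda>i. norm (f (e i) x)) sums g x" if "x \<in> space M" for x
    using norm'[OF that] by (rule has_sum_imp_sums)
  have F': "(\<Sum>i. f (e i) x) = F x" if "x \<in> space M" for x
  proof -
    have "((\<lambda>i. f (e i) x) has_sum F x) UNIV"
      using F[OF that] has_sum_reindex_bij_betw[OF e, of "\<lambda>k. f k x"] by simp
    from has_sum_imp_sums[OF this] show ?thesis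
      by (simp add: sums_iff)
  qed
  have summable_int: "summable (\<lambda>i. \<integral>x. norm (f (e i) x) \<partial>M)"
  proof (rule summableI_nonneg_bounded)
    fix n
    have "(\<Sum>i<n. \<integral>x. norm (f (e i) x) \<partial>M) = (\<integral>x. (\<Sum>i<n. norm (f (e i) x)) \<partial>M)"
      using f[OF eK] by (subst Bochner_Integration.integral_sum) auto
    also have "\<dots> \<le> (\<integral>x. g x \<partial>M)"
    proof (rule integral_mono)
      fix x assume "x \<in> space M"
      from sums[OF this] show "(\<Sum>i<n. norm (f (e i) x)) \<le> g x"
        using sum_le_suminf[of "\<lambda>i. norm (f (e i) x)" "{..<n}"] by (simp add: sums_iff)
    qed (use f[OF eK] g in auto)
    finally show "(\<Sum>i<n. \<integral>x. norm (f (e i) x) \<partial>M) \<le> (\<integral>x. g x \<partial>M)" .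
  qed auto
  have "(\<lambda>i. \<integral>x. f (e i) x \<partial>M) sums (\<integral>x. (\<Sum>i. f (e i) x) \<partial>M)"
    using sums by (intro sums_integral f eK summable_int AE_I2) (auto simp: sums_iff)
  also have "(\<integral>x. (\<Sum>i. f (e i) x) \<partial>M) = (\<integral>x. F x \<partial>M)"
    by (intro Bochner_Integration.integral_cong F' refl)
  finally have "(\<lambda>i. \<integral>x. f (e i) x \<partial>M) sums (\<integral>x. F x \<partial>M)" .
  \<comment> \<open>Absolute convergence makes the result independent of the enumeration and leads
    back to the unordered sum.\<close>
  moreover have "summable (\<lambda>i. norm (\<integral>x. f (e i) x \<partial>M))"
    by (rule summable_comparison_test'[OF summable_int]) (use integral_norm_bound in auto)
  ultimately have "((\<lambda>i. \<integral>x. f (e i) x \<partial>M) has_sum (\<integral>x. F x \<partial>M)) UNIV"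
    by (intro norm_summable_imp_has_sum)
  then have "((\<lambda>k. \<integral>x. f k x \<partial>M) has_sum (\<integral>x. F x \<partial>M)) K"
    using has_sum_reindex_bij_betw[OF e, of "\<lambda>k. \<integral>x. f k x \<partial>M"] by simp
  then show ?thesis by (rule infsumI)
qed

lemma countable_positive_indices: "countable (positive_indices :: ('n::finite \<Rightarrow> nat) set)"
proof -
  have "positive_indices = PiE UNIV (\<lambda>_::'n. {0::nat<..})"
    by (auto simp: positive_indices_def PiE_def)
  then show ?thesis by (auto intro: countable_PiE)
qed

lemma infinite_positive_indices: "infinite (positive_indices :: ('n::finite \<Rightarrow> nat) set)"
proof
  assume "finite (positive_indices :: ('n \<Rightarrow> nat) set)"
  moreover have "(\<lambda>k (_ :: 'n). Suc k) ` UNIV \<subseteq> positive_indices"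
    by (auto simp: positive_indices_def)
  ultimately have "finite ((\<lambda>k (_ :: 'n). Suc k) ` UNIV)"
    by (rule rev_finite_subset)
  moreover have "inj (\<lambda>k (_ :: 'n). Suc k)"
    by (auto simp: inj_def fun_eq_iff)
  ultimately show False
    using finite_imageD by blast
qed

lemma dirichlet_zeta_series_box:
  fixes j :: "'n::finite"
  defines "m \<equiv> CARD('n) - 1"
  assumes t: "t \<in> {1/2..2}" and s: "Re s > real CARD('n) / 2"
  shows "dirichlet_zeta_series (box j t) s =
    rGamma s * (mellin (box_rest m t) s + (\<Sum>i\<le>Suc m. of_real (main_coeff m t i) / (s - of_nat i / 2)))"
    (is "_ = rGamma s * ?I s")
proof -
  have Suc_m: "Suc m = CARD('n)"
    by (simp add: m_def)
  have t0: "t > 0" using t by simp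
  have s0: "Re s > 0"
    by (rule le_less_trans[OF _ s]) simp
  let ?l = "dirichlet_eigenvalue (box j t)"
  let ?f = "\<lambda>k x. indicator {0<..} x *\<^sub>R (complex_of_real x powr (s - 1) * of_real (exp (- (?l k * x))))"
  have I: "has_bochner_integral lborel
    (\<lambda>x. indicator {0<..} x *\<^sub>R (complex_of_real x powr (z - 1) * of_real (box_theta m t x))) (?I z)"
    if "Re z > real CARD('n) / 2" for z
    using has_bochner_integral_box_theta[OF t, of m z] that unfolding Suc_m by simp
  have f: "has_bochner_integral lborel (?f k) (Gamma s * of_real (?l k) powr (- s))" if "k \<in> positive_indices" for k
    by (intro has_bochner_integral_Gamma_scaled s0 dirichlet_eigenvalue_pos t0 that)
  have exp_sum: "((\<lambda>k. exp (- (?l k * x))) has_sum box_theta m t x) positive_indices" if "x > 0" for x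
    unfolding m_def by (intro exp_eigenvalue_has_sum t0 that)
  have "(\<Sum>\<^sub>\<infinity>k\<in>positive_indices. \<integral>x. ?f k x \<partial>lborel) =
        (\<integral>x. indicator {0<..} x *\<^sub>R (complex_of_real x powr (s - 1) * of_real (box_theta m t x)) \<partial>lborel)"
  proof (rule infsum_lebesgue_integral)
    show "integrable lborel (?f k)" if "k \<in> positive_indices" for k
      using f[OF that] by (simp add: has_bochner_integral_iff)
    \<comment> \<open>All exponentials are positive, so the norms sum to the norm of the total, and
      the heat trace itself supplies the integrable majorant.\<close>
    show "((\<lambda>k. norm (?f k x)) has_sum (norm (indicator {0<..} x *\<^sub>R
            (complex_of_real x powr (s - 1) * of_real (box_theta m t x))))) positive_indices" for x
    proof (cases "x > 0")
      case True
      then have "box_theta m t x \<ge> 0"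
        unfolding box_theta_def using t0
        by (intro mult_nonneg_nonneg zero_le_power less_imp_le[OF theta_pos]) auto
      with has_sum_cmult_right[OF exp_sum[OF True], of "norm (complex_of_real x powr (s - 1))"]
      show ?thesis using True by (simp add: norm_mult)
    qed auto
    show "integrable lborel (\<lambda>x. norm (indicator {0<..} x *\<^sub>R
            (complex_of_real x powr (s - 1) * of_real (box_theta m t x))))"
      using I[OF s] by (intro integrable_norm) (simp add: has_bochner_integral_iff)
    show "((\<lambda>k. ?f k x) has_sum (indicator {0<..} x *\<^sub>R
            (complex_of_real x powr (s - 1) * of_real (box_theta m t x)))) positive_indices" for x
    proof (cases "x > 0")
      case True
      have "((\<lambda>k. complex_of_real (exp (- (?l k * x)))) has_sum of_real (box_theta m t x)) positive_indices"
        by (intro has_sum_of_real exp_sum True)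
      from has_sum_cmult_right[OF this, of "complex_of_real x powr (s - 1)"]
      show ?thesis using True by simp
    qed auto
  qed (rule countable_positive_indices infinite_positive_indices)+
  also have "\<dots> = ?I s"
    using I[OF s] by (simp add: has_bochner_integral_iff)
  also have "(\<Sum>\<^sub>\<infinity>k\<in>positive_indices. \<integral>x. ?f k x \<partial>lborel) =
      (\<Sum>\<^sub>\<infinity>k\<in>positive_indices. Gamma s * of_real (?l k) powr (- s))"
    using f by (intro infsum_cong) (simp add: has_bochner_integral_iff)
  also have "\<dots> = Gamma s * dirichlet_zeta_series (box j t) s"
    by (simp add: infsum_cmult_right' dirichlet_zeta_series_def positive_indices_def)
  finally have "Gamma s * dirichlet_zeta_series (box j t) s = ?I s" .
  moreover have "Gamma s \<noteq> 0"
    using s0 by (intro Gamma_nonzero) (auto elim!: nonpos_Ints_cases)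
  ultimately show ?thesis
    by (simp add: rGamma_inverse_Gamma field_simps)
qed

section \<open>The derivative of the zeta function at zero\<close>

text \<open>
  The pole at \<open>0\<close> of the Mellin transform is absorbed into \<open>rGamma s / s = rGamma (s + 1)\<close>.
\<close>

definition zeta_formula :: "nat \<Rightarrow> real \<Rightarrow> complex \<Rightarrow> complex" where
  "zeta_formula m t s =
     rGamma s * (mellin (box_rest m t) s + (\<Sum>i\<in>{1..Suc m}. of_real (main_coeff m t i) / (s - of_nat i / 2))) +
     of_real (main_coeff m t 0) * rGamma (s + 1)"

definition zeta_poles :: "nat \<Rightarrow> complex set" where
  "zeta_poles m = (\<lambda>i. of_nat i / 2) ` {1..Suc m}"

lemma analytic_zeta_formula:
  assumes "t \<in> {1/2..2}" "s \<notin> zeta_poles m"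
  shows   "zeta_formula m t analytic_on {s}"
proof -
  have "finite (zeta_poles m)"
    by (simp add: zeta_poles_def)
  then have "open (- zeta_poles m)"
    by (intro open_Compl finite_imp_closed)
  moreover have "zeta_formula m t holomorphic_on - zeta_poles m"
    unfolding zeta_formula_def[abs_def] using assms(1)
    by (intro holomorphic_intros holomorphic_mellin rapid_box_rest) (auto simp: zeta_poles_def)
  ultimately show ?thesis
    using assms(2) by (auto simp: analytic_on_holomorphic)
qed

lemma meromorphic_zeta_formula:
  assumes "t \<in> {1/2..2}"
  shows   "zeta_formula m t meromorphic_on UNIV"
proof -
  have "mellin (box_rest m t) analytic_on UNIV"
    using holomorphic_mellin[OF rapid_box_rest[OF assms]] by (simp add: analytic_on_open)
  moreover have "(rGamma :: complex \<Rightarrow> complex) analytic_on UNIV" "(\<lambda>s :: complex. rGamma (s + 1)) analytic_on UNIV"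
    by (auto simp: analytic_on_open intro!: holomorphic_intros)
  ultimately show ?thesis
    unfolding zeta_formula_def[abs_def]
    by (intro meromorphic_intros analytic_on_imp_meromorphic_on analytic_intros)
qed

text \<open>\<open>remove_sings\<close> supplies the normalised values at poles and removable
  singularities that \<open>nicely_meromorphic_on\<close> asks for. In the half-plane of convergence
  the formula is analytic and keeps its values.\<close>

lemma is_dirichlet_zeta_box:
  fixes j :: "'n::finite"
  defines "m \<equiv> CARD('n) - 1"
  assumes t: "t \<in> {1/2..2}"
  shows "is_dirichlet_zeta (box j t) (remove_sings (zeta_formula m t))"
  unfolding is_dirichlet_zeta_def
proof (intro conjI allI impI)
  show "remove_sings (zeta_formula m t) nicely_meromorphic_on UNIV"
    by (intro remove_sings_nicely_meromorphic meromorphic_zeta_formula t)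
next
  fix s assume s: "Re s > real CARD('n) / 2"
  have Suc_m: "Suc m = CARD('n)"
    by (simp add: m_def)
  have s0: "s \<noteq> 0"
    using s by (auto simp: divide_less_0_iff)
  have "s \<notin> zeta_poles m"
  proof
    assume "s \<in> zeta_poles m"
    then obtain i where i: "i \<in> {1..Suc m}" "s = of_nat i / 2"
      unfolding zeta_poles_def by blast
    have "Re s = real i / 2" "real i \<le> real (Suc m)"
      using i(1) unfolding i(2) by simp_all
    with s show False unfolding Suc_m by linarith
  qed
  then have "remove_sings (zeta_formula m t) s = zeta_formula m t s"
    by (intro remove_sings_at_analytic analytic_zeta_formula t)
  also have "\<dots> = rGamma s * (mellin (box_rest m t) s +
      (\<Sum>i\<le>Suc m. of_real (main_coeff m t i) / (s - of_nat i / 2)))"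
  proof -
    have "{..Suc m} = insert 0 {1..Suc m}"
      by auto
    then have "(\<Sum>i\<le>Suc m. of_real (main_coeff m t i) / (s - of_nat i / 2)) =
        of_real (main_coeff m t 0) / s + (\<Sum>i\<in>{1..Suc m}. of_real (main_coeff m t i) / (s - of_nat i / 2))"
      by (simp only: sum.insert finite_atLeastAtMost) simp
    moreover have "rGamma s * (of_real (main_coeff m t 0) / s) = of_real (main_coeff m t 0) * rGamma (s + 1)"
      using s0 rGamma_plus1[of s] by (simp add: field_simps)
    ultimately show ?thesis
      by (simp only: zeta_formula_def distrib_left add_ac)
  qed
  also have "\<dots> = dirichlet_zeta_series (box j t) s"
    using dirichlet_zeta_series_box[OF t s] unfolding m_def by simp
  finally show "remove_sings (zeta_formula m t) s = dirichlet_zeta_series (box j t) s" .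
qed

text \<open>\<open>rGamma\<close> has a simple zero with derivative \<open>1\<close> at
  \<open>0\<close>, so differentiating \<open>rGamma s * A s\<close> there just evaluates
  \<open>A\<close> at \<open>0\<close>. The pole at \<open>i / 2\<close> thus contributes
  \<open>- 2 / i\<close> times its coefficient.\<close>

lemma zeta_prime_zero_box:
  fixes j :: "'n::finite"
  defines "m \<equiv> CARD('n) - 1"
  assumes t: "t \<in> {1/2..2}"
  shows "zeta_prime_zero (box j t) =
    of_real (rest_at_0 m t - (\<Sum>i\<in>{1..Suc m}. main_coeff m t i * (2 / real i))) +
    of_real (main_coeff m t 0) * deriv rGamma 1"
proof -
  have "dirichlet_zeta (box j t) = remove_sings (zeta_formula m t)"
    unfolding dirichlet_zeta_def m_def
    using is_dirichlet_zeta_box[OF t] is_dirichlet_zeta_unique by (intro the_equality) blast+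
  then have "zeta_prime_zero (box j t) = deriv (remove_sings (zeta_formula m t)) 0"
    by (simp add: zeta_prime_zero_def)
  also have "\<dots> = deriv (zeta_formula m t) 0"
  proof (rule deriv_cong_ev)
    have "0 \<notin> zeta_poles m"
      by (auto simp: zeta_poles_def)
    then show "eventually (\<lambda>s. remove_sings (zeta_formula m t) s = zeta_formula m t s) (nhds 0)"
      by (intro eventually_remove_sings_eq_nhds analytic_zeta_formula t)
  qed simp
  also have "\<dots> = (mellin (box_rest m t) 0 + (\<Sum>i\<in>{1..Suc m}. of_real (main_coeff m t i) / (0 - of_nat i / 2))) +
      of_real (main_coeff m t 0) * deriv rGamma 1"
  proof (rule DERIV_imp_deriv)
    define A where "A = (\<lambda>s. mellin (box_rest m t) s + (\<Sum>i\<in>{1..Suc m}. of_real (main_coeff m t i) / (s - of_nat i / 2)))"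
    have "A holomorphic_on - zeta_poles m"
      unfolding A_def using t
      by (intro holomorphic_intros holomorphic_mellin rapid_box_rest) (auto simp: zeta_poles_def)
    moreover have "open (- zeta_poles m)" "0 \<in> - zeta_poles m"
      by (auto simp: zeta_poles_def intro!: open_Compl finite_imp_closed)
    ultimately have A: "(A has_field_derivative deriv A 0) (at 0)"
      by (rule holomorphic_derivI)
    have R0: "((rGamma :: complex \<Rightarrow> complex) has_field_derivative 1) (at 0)"
      using has_field_derivative_rGamma_nonpos_int[of 0 UNIV] by simp
    have "((rGamma :: complex \<Rightarrow> complex) has_field_derivative deriv rGamma 1) (at (0 + 1))"
      by (simp add: DERIV_deriv_iff_field_differentiable field_differentiable_rGamma)
    then have R1: "((\<lambda>s :: complex. rGamma (s + 1)) has_field_derivative deriv rGamma 1) (at 0)"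
      by (simp only: DERIV_shift)
    \<comment> \<open>The summand with \<open>deriv A 0\<close> vanishes because
      \<open>rGamma 0 = 0\<close>.\<close>
    have "((\<lambda>s. rGamma s * A s + of_real (main_coeff m t 0) * rGamma (s + 1)) has_field_derivative
            (1 * A 0 + deriv A 0 * rGamma 0) + of_real (main_coeff m t 0) * deriv rGamma 1) (at 0)"
      by (intro DERIV_add DERIV_mult DERIV_cmult R0 R1 A)
    then show "(zeta_formula m t has_field_derivative
        (mellin (box_rest m t) 0 + (\<Sum>i\<in>{1..Suc m}. of_real (main_coeff m t i) / (0 - of_nat i / 2))) +
        of_real (main_coeff m t 0) * deriv rGamma 1) (at 0)"
      by (simp add: zeta_formula_def[abs_def] A_def)
  qed
  also have "(\<Sum>i\<in>{1..Suc m}. of_real (main_coeff m t i) / (0 - of_nat i / 2)) =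
      complex_of_real (- (\<Sum>i\<in>{1..Suc m}. main_coeff m t i * (2 / real i)))"
    unfolding of_real_minus of_real_sum sum_negf[symmetric]
    by (intro sum.cong) (auto simp: field_simps)
  finally show ?thesis
    unfolding mellin_box_rest_0 by simp
qed

section \<open>Dependence on the side length and the Lagrange multiplier\<close>

lemma main_coeff_affine: "\<exists>a b. \<forall>t. main_coeff m t i = a + t * b"
proof -
  let ?A = "[:- 1 / 2, 1 :: real:] ^ m"
  have "main_coeff m t i = (- 1 / 2 * coeff ?A i) * (theta_const / 2) ^ i +
          t * (coeff (pCons 0 ?A) i * (theta_const / 2) ^ i)" for t
  proof -
    have "?A * [:- 1 / 2, t:] = smult (- 1 / 2) ?A + smult t (pCons 0 ?A)"
      by simp
    then show ?thesis
      unfolding main_coeff_def by (simp only: coeff_add coeff_smult distrib_right mult.assoc)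
  qed
  then show ?thesis by blast
qed

text \<open>The constant term is a product of constants \<open>- 1 / 2\<close>, so the summand with
  \<open>deriv rGamma 1\<close> disappears on differentiating in \<open>t\<close>.\<close>

lemma main_coeff_0: "main_coeff m t 0 = main_coeff m 1 0"
  by (simp add: main_coeff_def coeff_mult_0)

lemma has_partial_derivative_equilateral_box:
  "has_partial_derivative F D j equilateral_box \<longleftrightarrow>
     ((\<lambda>t. F (box j t)) has_vector_derivative D) (at 1)"
proof -
  have "(\<chi> i. if i = j then t else equilateral_box $ i) = box j t" for t :: real
    by (simp add: vec_eq_iff box_def equilateral_box_def)
  moreover have "equilateral_box $ j = (1 :: real)"
    by (simp add: equilateral_box_def)
  ultimately show ?thesis
    by (simp only: has_partial_derivative_def)
qed

text \<open>\<open>D\<close> is chosen before \<open>j\<close>: the function \<open>H\<close> to be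
  differentiated depends only on the dimension. This uniformity is what yields a single
  multiplier.\<close>

lemma zeta_prime_zero_partial_derivative:
  "\<exists>D :: real. \<forall>j :: 'n::finite.
     has_partial_derivative zeta_prime_zero (complex_of_real D) j (equilateral_box :: real ^ 'n)"
proof -
  define m where "m = CARD('n) - 1"
  define H where "H = (\<lambda>t. rest_at_0 m t - (\<Sum>i\<in>{1..Suc m}. main_coeff m t i * (2 / real i)))"
  have "\<exists>D. (H has_real_derivative D) (at 1)"
  proof -
    obtain D where "(rest_at_0 m has_real_derivative D) (at 1)"
      using differentiable_rest_at_0 by blast
    moreover have "\<exists>D. ((\<lambda>t. main_coeff m t i) has_real_derivative D) (at 1)" for i
    proof -
      obtain a b where ab: "\<And>t. main_coeff m t i = a + t * b"
        using main_coeff_affine by blast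
      show ?thesis
        unfolding ab by (rule exI[of _ b]) (auto intro!: derivative_eq_intros)
    qed
    then obtain E where "\<And>i. ((\<lambda>t. main_coeff m t i) has_real_derivative E i) (at 1)"
      by metis
    ultimately have "(H has_real_derivative D - (\<Sum>i\<in>{1..Suc m}. E i * (2 / real i))) (at 1)"
      unfolding H_def by (intro DERIV_diff DERIV_sum DERIV_cmult_right)
    then show ?thesis by blast
  qed
  then obtain D where D: "(H has_real_derivative D) (at 1)" by blast
  have "has_partial_derivative zeta_prime_zero (complex_of_real D) j (equilateral_box :: real ^ 'n)" for j
  proof -
    have "((\<lambda>t. of_real (H t) + of_real (main_coeff m 1 0) * deriv rGamma 1) has_vector_derivative
            complex_of_real D + 0) (at 1)"
      by (intro has_vector_derivative_add has_vector_derivative_of_real D has_vector_derivative_const)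
    then have "((\<lambda>t. zeta_prime_zero (box j t)) has_vector_derivative complex_of_real D + 0) (at 1)"
    proof (rule has_vector_derivative_transform_within_open)
      show "of_real (H t) + of_real (main_coeff m 1 0) * deriv rGamma 1 = zeta_prime_zero (box j t)"
        if "t \<in> {1/2<..<2}" for t
        using that zeta_prime_zero_box[of t j] main_coeff_0[of m t] by (simp add: H_def m_def)
    qed auto
    then show ?thesis
      by (simp add: has_partial_derivative_equilateral_box)
  qed
  then show ?thesis by blast
qed

lemma volume_constraint_partial_derivative:
  "has_partial_derivative volume_constraint 2 j (equilateral_box :: real ^ 'n::finite)"
proof -
  have "volume_constraint (box j t) = t\<^sup>2 - 1" for t
  proof -
    have "(\<Prod>i\<in>UNIV. (box j t $ i)\<^sup>2) = (box j t $ j)\<^sup>2 * (\<Prod>i\<in>UNIV - {j}. (box j t $ i)\<^sup>2)"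
      by (rule prod.remove) auto
    also have "(\<Prod>i\<in>UNIV - {j}. (box j t $ i)\<^sup>2) = 1"
      by (intro prod.neutral) (auto simp: box_def)
    finally show ?thesis by (simp add: volume_constraint_def box_def)
  qed
  moreover have "((\<lambda>t :: real. t\<^sup>2 - 1) has_vector_derivative 2) (at 1)"
    by (auto intro!: derivative_eq_intros simp: has_real_derivative_iff_has_vector_derivative[symmetric])
  ultimately show ?thesis
    by (simp add: has_partial_derivative_equilateral_box)
qed

theorem mainTheorem5:
  shows "volume_constraint (equilateral_box :: real ^ 'n::finite) = 0 \<and>
    (\<exists>l :: real. \<forall>j :: 'n. \<exists>dh dg.
       has_partial_derivative zeta_prime_zero dh j equilateral_box \<and>
       has_partial_derivative volume_constraint dg j equilateral_box \<and>
       dh = complex_of_real (l * dg))"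
proof
  show "volume_constraint (equilateral_box :: real ^ 'n) = 0"
    by (simp add: volume_constraint_def equilateral_box_def)
  obtain D :: real where D: "\<And>j :: 'n. has_partial_derivative zeta_prime_zero (complex_of_real D) j equilateral_box"
    using zeta_prime_zero_partial_derivative by blast
  show "\<exists>l :: real. \<forall>j :: 'n. \<exists>dh dg.
       has_partial_derivative zeta_prime_zero dh j equilateral_box \<and>
       has_partial_derivative volume_constraint dg j equilateral_box \<and>
       dh = complex_of_real (l * dg)"
  proof (intro exI allI conjI)
    fix j :: 'n
    show "has_partial_derivative zeta_prime_zero (complex_of_real D) j equilateral_box"
      by (rule D)
    show "has_partial_derivative volume_constraint 2 j equilateral_box"
      by (rule volume_constraint_partial_derivative)
    \<comment> \<open>The multiplier is \<open>D / 2\<close>, since every partial derivative of the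
      constraint equals \<open>2\<close>.\<close>
    show "complex_of_real D = complex_of_real (D / 2 * 2)"
      by simp
  qed
qed

end
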